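(* There exist absolute constants $L>0$ and $C>0$ such that for all real $x>1$, $$f(x)\le\widetilde f(x)\le C\exp\big(L(\log\log x)^2\big).$$
   Context: $\mathbb{N}$ denotes the set of positive integers. $V_\infty=\{x^k: x,k\in\mathbb{N},\ k\ge2\}$ is the set of perfect powers. For a nonzero integer $n$, a set $A$ of positive integers has property $D_{\le\infty}(n)$ if $ab+n\in V_\infty$ for all $a,b\in A$ with $a\ne b$. For real $x\ge1$, $$f(x)=\max\{|A|: A\subseteq[1,x]\cap\mathbb{N}\text{ has property }D_{\le\infty}(n)\text{ for some integer }n\text{ with }1\le n\le x\},$$ $$\widetilde f(x)=\max\{|A|: A\subseteq[1,x]\cap\mathbb{N}\text{ has property }D_{\le\infty}(n)\text{ for some integer }n\text{ with }1\le|n|\le x\}.$$ $\log$ is the natural logarithm. *)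

theory Defs
  imports Complex_Main
begin

definition perfect_powers :: "nat set" where
  "perfect_powers = {y ^ k | y k :: nat. y \<ge> 1 \<and> k \<ge> 2}"

text \<open>The shift \<open>n\<close> may be negative, so \<open>a b + n\<close> is computed in the integers; in particular it
  has to be positive to be a perfect power.\<close>

definition D_property :: "int \<Rightarrow> nat set \<Rightarrow> bool" where
  "D_property n A \<longleftrightarrow>
     (\<forall>a\<in>A. a \<ge> 1) \<and>
     (\<forall>a\<in>A. \<forall>b\<in>A. a \<noteq> b \<longrightarrow> int a * int b + n \<in> int ` perfect_powers)"

definition f :: "real \<Rightarrow> nat" where
  "f x = Max {card A | A. (\<forall>a\<in>A. 1 \<le> a \<and> real a \<le> x) \<and>
     (\<exists>n::int. 1 \<le> n \<and> of_int n \<le> x \<and> D_property n A)}"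

definition f_tilde :: "real \<Rightarrow> nat" where
  "f_tilde x = Max {card A | A. (\<forall>a\<in>A. 1 \<le> a \<and> real a \<le> x) \<and>
     (\<exists>n::int. 1 \<le> \<bar>n\<bar> \<and> of_int \<bar>n\<bar> \<le> x \<and> D_property n A)}"

text \<open>Both maxima are taken over finite nonempty sets.\<close>

lemma finite_cards:
  fixes x :: real
  shows "finite {card A | A. (\<forall>a\<in>A. 1 \<le> a \<and> real a \<le> x) \<and> P A}"
proof -
  have "A \<in> Pow {..nat \<lfloor>x\<rfloor>}" if "\<forall>a\<in>A. 1 \<le> a \<and> real a \<le> x" for A :: "nat set"
    using that by (auto simp: le_nat_floor)
  then have "{card A | A. (\<forall>a\<in>A. 1 \<le> a \<and> real a \<le> x) \<and> P A} \<subseteq> card ` Pow {..nat \<lfloor>x\<rfloor>}"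
    by blast
  then show ?thesis
    by (rule finite_subset) simp
qed

lemma zero_in_cards:
  fixes x :: real
  assumes "x \<ge> 1"
  shows "0 \<in> {card A | A. (\<forall>a\<in>A. 1 \<le> a \<and> real a \<le> x) \<and>
           (\<exists>n::int. 1 \<le> n \<and> of_int n \<le> x \<and> D_property n A)}"
    and "0 \<in> {card A | A. (\<forall>a\<in>A. 1 \<le> a \<and> real a \<le> x) \<and>
           (\<exists>n::int. 1 \<le> \<bar>n\<bar> \<and> of_int \<bar>n\<bar> \<le> x \<and> D_property n A)}"
  using assms by (auto simp: D_property_def intro!: exI[of _ "{}"] exI[of _ "1::int"])

end

theory Submission
  imports Defs "HOL-Complex_Analysis.Complex_Analysis"
begin

text \<open>Colour a pair \<open>{a, b}\<close> of elements of \<open>A \<subseteq> {1..2^l}\<close> by an exponent \<open>k \<le> 2 * l + 1\<close> for which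
  \<open>a * b + n\<close> is a \<open>k\<close>-th power. By a Kovari-Sos-Turan argument, if \<open>A\<close> is large, then one colour
  contains a complete bipartite graph on \<open>S\<close> and \<open>B\<close> with \<open>card S\<close> of order \<open>log l\<close> and \<open>B\<close> large.

  For \<open>b \<in> B\<close> all monomials of degree less than \<open>k\<close> in each of the radicals \<open>(a * b + n) powr (1 / k)\<close>,
  \<open>a \<in> S\<close>, are integers, and there are \<open>k ^ card S\<close> of them. As soon as this number exceeds a multiple of
  \<open>l * card S\<close>, the pigeonhole principle applied to Taylor coefficients gives an integer combination of these
  monomials that is smaller than 1, hence 0, at all \<open>b \<in> B\<close> in a dyadic interval to the right of the
  branch points. The monomials are linearly independent over the polynomials in \<open>b\<close>, so a nonzero multiple of
  that combination is a polynomial of degree at most \<open>card S * k ^ card S\<close> in \<open>b\<close>, which bounds \<open>card B\<close>.\<close>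

section \<open>Algebraic tools: linear systems and residues of logarithmic derivatives\<close>

text \<open>Gaussian elimination, one equation at a time: a nonzero coefficient of the new equation
  eliminates its unknown from the remaining ones, so that equations and unknowns both drop by one. A
  zero equation is simply dropped.\<close>

lemma homogeneous_system_solution:
  fixes m :: "'j \<Rightarrow> 'i \<Rightarrow> 'k::field"
  assumes "finite J" "finite I" "card J < card I"
  shows "\<exists>c. (\<exists>i\<in>I. c i \<noteq> 0) \<and> (\<forall>j\<in>J. (\<Sum>i\<in>I. m j i * c i) = 0)"
  using assms
proof (induction J arbitrary: I m rule: finite_induct)
  case empty
  then have "I \<noteq> {}" by auto
  then show ?case by (intro exI[of _ "\<lambda>_. 1"]) auto
next
  case (insert j J)
  show ?case
  proof (cases "\<forall>i\<in>I. m j i = 0")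
    case True
    have "card J < card I" using insert by simp
    with insert.IH[OF insert.prems(1), of m] True show ?thesis by auto
  next
    case False
    then obtain i0 where i0: "i0 \<in> I" "m j i0 \<noteq> 0" by auto
    define I' where "I' = I - {i0}"
    define m' where "m' = (\<lambda>j' i. m j' i - m j' i0 * m j i / m j i0)"
    have fin: "finite I'" using insert.prems by (simp add: I'_def)
    have "card J < card I'" using insert i0 by (simp add: I'_def)
    with insert.IH[OF fin, of m'] obtain c where c: "\<exists>i\<in>I'. c i \<noteq> 0"
      "\<And>j'. j' \<in> J \<Longrightarrow> (\<Sum>i\<in>I'. m' j' i * c i) = 0" by auto
    \<comment> \<open>Back substitution: equation \<open>j\<close> forces the value at the pivot
      \<open>i0\<close>.\<close>
    define d where "d = c(i0 := - (\<Sum>i\<in>I'. m j i * c i) / m j i0)"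
    have row: "(\<Sum>i\<in>I. m j' i * d i) = m j' i0 * d i0 + (\<Sum>i\<in>I'. m j' i * c i)" for j'
    proof -
      have "(\<Sum>i\<in>I. m j' i * d i) = m j' i0 * d i0 + (\<Sum>i\<in>I'. m j' i * d i)"
        unfolding I'_def using i0 insert.prems by (subst sum.remove[of _ i0]) auto
      also have "(\<Sum>i\<in>I'. m j' i * d i) = (\<Sum>i\<in>I'. m j' i * c i)"
        by (rule sum.cong) (auto simp: d_def I'_def)
      finally show ?thesis .
    qed
    have "(\<Sum>i\<in>I. m j' i * d i) = 0" if "j' \<in> insert j J" for j'
    proof (cases "j' = j")
      case True
      then show ?thesis using i0 by (simp add: row) (simp add: d_def)
    next
      case False
      then have "j' \<in> J" using that by auto
      have "(\<Sum>i\<in>I'. m' j' i * c i)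
          = (\<Sum>i\<in>I'. m j' i * c i) - m j' i0 / m j i0 * (\<Sum>i\<in>I'. m j i * c i)"
        by (simp add: m'_def sum_distrib_left algebra_simps sum_subtractf)
      with c(2)[OF \<open>j' \<in> J\<close>] show ?thesis by (simp add: row) (simp add: d_def)
    qed
    moreover have "\<exists>i\<in>I. d i \<noteq> 0" using c(1) by (auto simp: d_def I'_def)
    ultimately show ?thesis by blast
  qed
qed

text \<open>The equation says that the logarithmic derivative of \<open>P / Q\<close> is
  \<open>- V / ((x - r) * U)\<close>. The conclusion compares the residues at \<open>r\<close>,
  multiplied by \<open>poly U r\<close>.\<close>

lemma order_log_derivative:
  fixes P Q U V :: "'a::{field_char_0} poly"
  assumes "P \<noteq> 0" "Q \<noteq> 0"
    and eq: "(pderiv P * Q - P * pderiv Q) * ([:- r, 1:] * U) + P * Q * V = 0"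
    and U: "poly U r \<noteq> 0"
  shows "(of_nat (order r P) - of_nat (order r Q)) * poly U r + poly V r = 0"
proof -
  define X where "X = [:- r, 1:]"
  obtain u where u: "P = X ^ order r P * u" "\<not> X dvd u"
    using order_decomp[OF assms(1), of r] by (auto simp: X_def)
  obtain v where v: "Q = X ^ order r Q * v" "\<not> X dvd v"
    using order_decomp[OF assms(2), of r] by (auto simp: X_def)
  define m n where "m = order r P" and "n = order r Q"
  \<comment> \<open>\<open>X\<close> times the derivative acts on \<open>X ^ i\<close> as
    multiplication by \<open>i\<close>; this is how the orders enter.\<close>
  have dX: "X * pderiv (X ^ i) = smult (of_nat i) (X ^ i)" for i
  proof (induction i)
    case (Suc i)
    have "pderiv X = 1" by (simp add: X_def pderiv_pCons)
    then have "X * pderiv (X ^ Suc i) = X * (X * pderiv (X ^ i)) + X * X ^ i"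
      by (simp only: power_Suc pderiv_mult) (simp add: algebra_simps)
    then show ?case using Suc by (simp add: algebra_simps smult_add_left)
  qed simp
  have dP: "X * pderiv P = X ^ m * (smult (of_nat m) u + X * pderiv u)"
  proof -
    have "X * pderiv P = (X * pderiv (X ^ m)) * u + X ^ m * (X * pderiv u)"
      by (subst u(1), subst m_def[symmetric]) (simp only: pderiv_mult algebra_simps)
    then show ?thesis by (simp only: dX) (simp add: algebra_simps)
  qed
  have dQ: "X * pderiv Q = X ^ n * (smult (of_nat n) v + X * pderiv v)"
  proof -
    have "X * pderiv Q = (X * pderiv (X ^ n)) * v + X ^ n * (X * pderiv v)"
      by (subst v(1), subst n_def[symmetric]) (simp only: pderiv_mult algebra_simps)
    then show ?thesis by (simp only: dX) (simp add: algebra_simps)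
  qed
  have P: "P = X ^ m * u" and Q: "Q = X ^ n * v" using u v by (auto simp: m_def n_def)
  \<comment> \<open>Moving the factor \<open>X\<close> onto the derivatives makes
    \<open>X ^ m * X ^ n\<close> a common factor. Once it is cancelled, evaluation at
    \<open>r\<close> removes every term that still contains \<open>X\<close>.\<close>
  have "0 = ((X * pderiv P) * Q - P * (X * pderiv Q)) * U + P * Q * V"
    using eq by (simp only: X_def[symmetric]) (simp add: algebra_simps)
  also have "\<dots> = (X ^ m * X ^ n) * (((smult (of_nat m) u + X * pderiv u) * v
      - u * (smult (of_nat n) v + X * pderiv v)) * U + u * v * V)"
    by (simp only: dP dQ) (simp only: P Q algebra_simps)
  finally have "((smult (of_nat m) u + X * pderiv u) * v
      - u * (smult (of_nat n) v + X * pderiv v)) * U + u * v * V = 0"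
    by (simp add: X_def)
  then have "poly (((smult (of_nat m) u + X * pderiv u) * v
      - u * (smult (of_nat n) v + X * pderiv v)) * U + u * v * V) r = 0" by simp
  then have "poly u r * poly v r * ((of_nat m - of_nat n) * poly U r + poly V r) = 0"
    by (simp add: X_def algebra_simps)
  moreover have "poly u r \<noteq> 0" "poly v r \<noteq> 0"
    using u(2) v(2) by (auto simp: X_def poly_eq_0_iff_dvd)
  ultimately show ?thesis by (simp add: m_def n_def)
qed

section \<open>Complete bipartite graphs in one colour\<close>

text \<open>By averaging, each \<open>b\<close> has a popular colour, and one colour is the chosen
  popular one for at least a fraction \<open>1 / K\<close> of all \<open>b\<close>. Within that
  colour the elements of \<open>S\<close> are chosen greedily, each keeping at least a fraction
  \<open>1 / (2 * K)\<close> of the current \<open>B\<close>; hence the factor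
  \<open>K * (2 * K) ^ s\<close>.\<close>

lemma monochromatic_biclique:
  fixes R :: "'k \<Rightarrow> 'a \<Rightarrow> 'a \<Rightarrow> bool"
  assumes fin: "finite A" "finite C" and K: "card C \<le> K"
    and col: "\<And>a b. a \<in> A \<Longrightarrow> b \<in> A \<Longrightarrow> a \<noteq> b \<Longrightarrow> \<exists>k\<in>C. R k a b"
    and big: "2 * (s * K + 1) \<le> card A"
  shows "\<exists>k\<in>C. \<exists>S B. S \<subseteq> A \<and> B \<subseteq> A \<and> card S = s \<and> (\<forall>a\<in>S. \<forall>b\<in>B. R k a b) \<and>
           card A \<le> K * (2 * K) ^ s * card B"
proof -
  define m where "m = card A"
  define N where "N = (\<lambda>k b. {a \<in> A. R k a b})"
  have finN: "finite (N k b)" for k b using fin by (simp add: N_def)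
  have pop: "\<exists>k\<in>C. m - 1 \<le> K * card (N k b)" if "b \<in> A" for b
  proof (rule ccontr)
    assume "\<not> ?thesis"
    then have less: "\<And>k. k \<in> C \<Longrightarrow> K * card (N k b) < m - 1" by force
    have "A - {b} \<subseteq> (\<Union>k\<in>C. N k b)" using col that by (auto simp: N_def)
    then have "card (A - {b}) \<le> card (\<Union>k\<in>C. N k b)"
      by (intro card_mono) (use fin finN in auto)
    also have "\<dots> \<le> (\<Sum>k\<in>C. card (N k b))" by (rule card_UN_le) (use fin in auto)
    finally have le: "m - 1 \<le> (\<Sum>k\<in>C. card (N k b))" using that fin by (simp add: m_def)
    have "C \<noteq> {}" using le big by (auto simp: m_def)
    have "K * (m - 1) \<le> (\<Sum>k\<in>C. K * card (N k b))" using le by (simp flip: sum_distrib_left)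
    also have "\<dots> < (\<Sum>k\<in>C. m - 1)"
      by (rule sum_strict_mono) (use less fin \<open>C \<noteq> {}\<close> in auto)
    also have "\<dots> \<le> K * (m - 1)" using K by simp
    finally show False by simp
  qed
  then obtain kk where kk: "\<And>b. b \<in> A \<Longrightarrow> kk b \<in> C" "\<And>b. b \<in> A \<Longrightarrow> m - 1 \<le> K * card (N (kk b) b)"
    by metis
  have "\<exists>k\<in>C. m \<le> K * card {b \<in> A. kk b = k}"
  proof (rule ccontr)
    assume "\<not> ?thesis"
    then have less: "\<And>k. k \<in> C \<Longrightarrow> K * card {b \<in> A. kk b = k} < m" by force
    have "A \<subseteq> (\<Union>k\<in>C. {b \<in> A. kk b = k})" using kk by auto
    then have "m \<le> card (\<Union>k\<in>C. {b \<in> A. kk b = k})"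
      unfolding m_def by (intro card_mono) (use fin in auto)
    also have "\<dots> \<le> (\<Sum>k\<in>C. card {b \<in> A. kk b = k})" by (rule card_UN_le) (use fin in auto)
    finally have le: "m \<le> (\<Sum>k\<in>C. card {b \<in> A. kk b = k})" .
    have "C \<noteq> {}" using le big by (auto simp: m_def)
    have "K * m \<le> (\<Sum>k\<in>C. K * card {b \<in> A. kk b = k})" using le by (simp flip: sum_distrib_left)
    also have "\<dots> < (\<Sum>k\<in>C. m)"
      by (rule sum_strict_mono) (use less fin \<open>C \<noteq> {}\<close> in auto)
    also have "\<dots> \<le> K * m" using K by simp
    finally show False by simp
  qed
  then obtain k where k: "k \<in> C" "m \<le> K * card {b \<in> A. kk b = k}" by auto
  define B0 where "B0 = {b \<in> A. kk b = k}"
  have deg: "m - 1 \<le> K * card (N k b)" if "b \<in> B0" for b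
    using that kk(2)[of b] by (auto simp: B0_def)
  have "\<exists>S B. S \<subseteq> A \<and> B \<subseteq> B0 \<and> card S = t \<and> (\<forall>a\<in>S. \<forall>b\<in>B. R k a b) \<and>
          card B0 \<le> (2 * K) ^ t * card B" if "t \<le> s" for t
    using that
  proof (induction t)
    case 0
    then show ?case by (intro exI[of _ "{}"] exI[of _ B0]) auto
  next
    case (Suc t)
    then obtain S B where SB: "S \<subseteq> A" "B \<subseteq> B0" "card S = t" "\<forall>a\<in>S. \<forall>b\<in>B. R k a b"
      "card B0 \<le> (2 * K) ^ t * card B" by auto
    have finS: "finite S" and finB: "finite B"
      using SB fin by (auto simp: B0_def intro: finite_subset)
    have "\<exists>a\<in>A - S. card B \<le> 2 * K * card {b \<in> B. R k a b}"
    proof (rule ccontr)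
      assume "\<not> ?thesis"
      then have less: "\<And>a. a \<in> A - S \<Longrightarrow> 2 * K * card {b \<in> B. R k a b} < card B" by force
      \<comment> \<open>The \<open>t < s\<close> elements already in \<open>S\<close> account for at
        most \<open>K * t\<close> of the \<open>m - 1\<close>. By \<open>big\<close>, discarding
        them costs no more than a factor 2 in the density.\<close>
      have many: "m \<le> 2 * K * card {a \<in> A - S. R k a b}" if "b \<in> B" for b
      proof -
        have "{a \<in> A - S. R k a b} = N k b - S" by (auto simp: N_def)
        then have "card (N k b) \<le> card {a \<in> A - S. R k a b} + t"
          using diff_card_le_card_Diff[OF finS, of "N k b"] SB(3) by simp
        then have "K * card (N k b) \<le> K * card {a \<in> A - S. R k a b} + K * t"
          by (metis add_mult_distrib2 mult_le_mono2)
        moreover have "K * t + K \<le> s * K" using Suc.prems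
          by (metis add.commute mult.commute mult_Suc_right mult_le_mono2)
        moreover have "m - 1 \<le> K * card (N k b)" using deg SB(2) that by auto
        ultimately show ?thesis using big by (simp add: m_def)
      qed
      have "A - S \<noteq> {}"
      proof
        assume "A - S = {}"
        then have "card A \<le> card S" using finS by (intro card_mono) auto
        moreover have "K \<noteq> 0" using k(2) big by (cases "K = 0") (auto simp: m_def)
        then have "s * 1 \<le> s * K" by (intro mult_le_mono2) simp
        then have "2 * (s * 1 + 1) \<le> 2 * (s * K + 1)" by simp
        from le_trans[OF this big] have "s + 1 \<le> card A" by simp
        ultimately show False using SB(3) big Suc.prems by linarith
      qed
      \<comment> \<open>Double counting of the related pairs between \<open>A - S\<close> and
        \<open>B\<close>: if no \<open>a\<close> kept enough of \<open>B\<close>, the total would be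
        too small.\<close>
      have "card B * m \<le> (\<Sum>b\<in>B. 2 * K * card {a \<in> A - S. R k a b})"
        using sum_mono[OF many] by (simp add: mult.commute)
      also have "\<dots> = 2 * K * (\<Sum>b\<in>B. card {a \<in> A - S. R k a b})"
        by (simp add: sum_distrib_left)
      also have "(\<Sum>b\<in>B. card {a \<in> A - S. R k a b}) = (\<Sum>a\<in>A - S. card {b \<in> B. R k a b})"
        using sum.swap_restrict[of B "A - S" "\<lambda>_ _. 1::nat" "\<lambda>b a. R k a b"] fin finB
        by simp
      also have "2 * K * \<dots> = (\<Sum>a\<in>A - S. 2 * K * card {b \<in> B. R k a b})"
        by (simp add: sum_distrib_left)
      also have "\<dots> < (\<Sum>a\<in>A - S. card B)"
        by (rule sum_strict_mono) (use less fin \<open>A - S \<noteq> {}\<close> in auto)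
      also have "\<dots> \<le> card B * m"
        using fin by (simp add: m_def card_mono)
      finally show False by simp
    qed
    then obtain a where a: "a \<in> A - S" "card B \<le> 2 * K * card {b \<in> B. R k a b}" by auto
    have "card B0 \<le> (2 * K) ^ t * (2 * K * card {b \<in> B. R k a b})"
      using SB(5) a(2) by (meson le_trans mult_le_mono2)
    then show ?case
      using SB a finS by (intro exI[of _ "insert a S"] exI[of _ "{b \<in> B. R k a b}"])
        (auto simp: mult_ac)
  qed
  from this[of s] obtain S B where SB: "S \<subseteq> A" "B \<subseteq> B0" "card S = s" "\<forall>a\<in>S. \<forall>b\<in>B. R k a b"
    "card B0 \<le> (2 * K) ^ s * card B" by auto
  have "m \<le> K * card B0" using k by (simp add: B0_def)
  also have "\<dots> \<le> K * ((2 * K) ^ s * card B)" using SB(5) by (rule mult_le_mono2)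
  finally have "card A \<le> K * (2 * K) ^ s * card B" by (simp add: m_def mult_ac)
  moreover have "B \<subseteq> A" using SB by (auto simp: B0_def)
  ultimately show ?thesis using k(1) SB by blast
qed

section \<open>Pigeonhole principle for Taylor coefficients\<close>

text \<open>In the manner of Siegel's lemma, the first \<open>2 * h\<close> Taylor coefficients of
  the combination are made small by the pigeonhole principle over coefficients in
  \<open>0..2 ^ h\<close>. The remaining ones are damped by powers of \<open>1 / 2\<close>, as
  \<open>v\<close> stays within half the radius. Since \<open>v\<close> is real, taking real parts
  is compatible with the expansion, so only real linear forms have to be controlled.\<close>

lemma small_integer_combination:
  fixes g :: "'e \<Rightarrow> complex \<Rightarrow> complex" and \<xi> :: complex and R B :: real
  assumes fin: "finite E" and R: "R > 0"
    and hol: "\<And>e. e \<in> E \<Longrightarrow> g e holomorphic_on ball \<xi> R"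
    and cont: "\<And>e. e \<in> E \<Longrightarrow> continuous_on (cball \<xi> R) (g e)"
    and bd: "\<And>e z. e \<in> E \<Longrightarrow> z \<in> cball \<xi> R \<Longrightarrow> norm (g e z) \<le> B"
    and h: "16 * card E * B \<le> 2 ^ h" and E: "4 * h + 2 \<le> card E"
  shows "\<exists>c::'e \<Rightarrow> int. (\<exists>e\<in>E. c e \<noteq> 0) \<and>
    (\<forall>v::real. \<bar>v\<bar> \<le> R / 2 \<longrightarrow> \<bar>\<Sum>e\<in>E. of_int (c e) * Re (g e (\<xi> + of_real v))\<bar> < 1)"
proof -
  define H :: nat where "H = 2 ^ h"
  define M where "M = 2 * h"
  define N where "N = card E"
  have N: "N > 0" using E by (simp add: N_def)
  have HB: "16 * N * B \<le> H" using h by (simp add: H_def N_def)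
  have HM: "2 ^ M = real H * H" by (simp add: M_def H_def power_add[symmetric] mult_2)
  \<comment> \<open>The scaling by \<open>R ^ j\<close> makes Cauchy's inequality a bound by
    \<open>B\<close> that is uniform in \<open>j\<close>.\<close>
  define u where "u = (\<lambda>e j. Re ((deriv ^^ j) (g e) \<xi> / fact j) * R ^ j)"
  obtain e0 where e0: "e0 \<in> E" using N by (auto simp: N_def card_gt_0_iff)
  have B: "B \<ge> 0" using bd[OF e0, of \<xi>] R by (meson norm_ge_zero order_trans less_imp_le centre_in_cball)
  have ub: "\<bar>u e j\<bar> \<le> B" if e: "e \<in> E" for e j
  proof -
    have "norm ((deriv ^^ j) (g e) \<xi>) \<le> fact j * B / R ^ j"
      by (rule Cauchy_inequality[OF hol[OF e] cont[OF e] R]) (use bd[OF e] in \<open>auto simp: dist_norm\<close>)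
    then have "norm ((deriv ^^ j) (g e) \<xi> / fact j) \<le> B / R ^ j"
      by (simp add: norm_divide field_simps)
    then have "\<bar>Re ((deriv ^^ j) (g e) \<xi> / fact j)\<bar> \<le> B / R ^ j"
      using abs_Re_le_cmod order_trans by blast
    then show ?thesis using R by (simp add: u_def abs_mult field_simps)
  qed
  have expand: "(\<lambda>j. u e j * (v / R) ^ j) sums Re (g e (\<xi> + of_real v))"
    if e: "e \<in> E" and v: "\<bar>v\<bar> \<le> R / 2" for e v
  proof -
    have "(\<lambda>j. (deriv ^^ j) (g e) \<xi> / fact j * (\<xi> + of_real v - \<xi>) ^ j) sums g e (\<xi> + of_real v)"
      by (rule holomorphic_power_series[OF hol[OF e]]) (use v R in \<open>auto simp: dist_norm\<close>)
    then have "(\<lambda>j. Re ((deriv ^^ j) (g e) \<xi> / fact j * of_real (v ^ j))) sums Re (g e (\<xi> + of_real v))"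
      by (intro sums_Re) simp
    moreover have "Re ((deriv ^^ j) (g e) \<xi> / fact j * of_real (v ^ j)) = u e j * (v / R) ^ j" for j
    proof -
      have "Re (w * of_real x) = Re w * x" for w x by simp
      then show ?thesis using R by (simp only: u_def) (simp add: power_divide)
    qed
    ultimately show ?thesis by simp
  qed
  have lin: "\<bar>\<Sum>e\<in>E. c e * u e j\<bar> \<le> real H * real H / 16" if c: "\<And>e. e \<in> E \<Longrightarrow> \<bar>c e\<bar> \<le> real H" for c j
  proof -
    have "\<bar>\<Sum>e\<in>E. c e * u e j\<bar> \<le> (\<Sum>e\<in>E. \<bar>c e * u e j\<bar>)" by (rule sum_abs)
    also have "\<dots> \<le> (\<Sum>e\<in>E. H * B)"
      by (rule sum_mono) (use c ub in \<open>auto simp: abs_mult intro!: mult_mono\<close>)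
    also have "\<dots> = H * (16 * N * B) / 16" by (simp add: N_def)
    also have "\<dots> \<le> real H * real H / 16" using mult_left_mono[OF HB, of "real H"] by simp
    finally show ?thesis .
  qed
  define W where "W = int H * int H"
  \<comment> \<open>The map sends a coefficient vector to its box of side \<open>1 / 4\<close>. Both
    sides are spaces of extensional functions, so that counting by \<open>PiE\<close> is
    exact.\<close>
  define \<Phi> where "\<Phi> = (\<lambda>c::'e \<Rightarrow> nat. restrict (\<lambda>j. \<lfloor>4 * (\<Sum>e\<in>E. real (c e) * u e j)\<rfloor>) {..<M})"
  define C where "C = PiE E (\<lambda>_. {..H})"
  have Hpos: "H > 0" by (simp add: H_def)
  have into: "\<Phi> ` C \<subseteq> PiE {..<M} (\<lambda>_. {-W..<W})"
  proof (rule image_subsetI)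
    fix c assume c: "c \<in> C"
    have "\<lfloor>4 * (\<Sum>e\<in>E. real (c e) * u e j)\<rfloor> \<in> {-W..<W}" for j
    proof -
      have "\<bar>\<Sum>e\<in>E. real (c e) * u e j\<bar> \<le> real H * real H / 16"
        by (rule lin) (use c in \<open>auto simp: C_def PiE_def Pi_def\<close>)
      moreover have "of_int W = real H * real H" by (simp add: W_def)
      moreover have "real H * real H > 0" using Hpos by simp
      ultimately have "- of_int W \<le> 4 * (\<Sum>e\<in>E. real (c e) * u e j)"
        "4 * (\<Sum>e\<in>E. real (c e) * u e j) < of_int W" by linarith+
      then show ?thesis by (auto simp: le_floor_iff floor_less_iff)
    qed
    then show "\<Phi> c \<in> PiE {..<M} (\<lambda>_. {-W..<W})" by (auto simp: \<Phi>_def)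
  qed
  \<comment> \<open>There are \<open>(2 * H * H) ^ M = 2 ^ (h * (4 * h + 2))\<close> boxes, at most
    \<open>H ^ N\<close> by the hypothesis \<open>E\<close>, but \<open>(H + 1) ^ N\<close>
    coefficient vectors. The difference of two vectors in one box is the combination sought.\<close>
  have "card (\<Phi> ` C) \<le> card (PiE {..<M} (\<lambda>_. {-W..<W}))"
    by (rule card_mono[OF _ into]) (auto intro: finite_PiE)
  also have "\<dots> = (2 ^ (2 * h + 1)) ^ M"
  proof -
    have "W - - W = int (2 * (H * H))" by (simp add: W_def)
    then have "card {-W..<W} = 2 * (H * H)" by (simp only: card_atLeastLessThan_int nat_int)
    also have "\<dots> = 2 ^ (2 * h + 1)" by (simp add: H_def power_add mult_2)
    finally show ?thesis by (simp add: card_PiE)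
  qed
  also have "\<dots> = 2 ^ (h * (4 * h + 2))"
    unfolding power_mult[symmetric] by (simp add: M_def algebra_simps)
  also have "\<dots> \<le> 2 ^ (h * N)" using E by (intro power_increasing mult_le_mono2) (auto simp: N_def)
  also have "\<dots> = H ^ N" by (simp add: H_def power_mult)
  also have "\<dots> < (H + 1) ^ N" using N by (intro power_strict_mono) auto
  also have "\<dots> = card C" by (simp add: C_def card_PiE fin N_def)
  finally have "\<not> inj_on \<Phi> C" using card_image by fastforce
  then obtain c1 c2 where c12: "c1 \<in> C" "c2 \<in> C" "c1 \<noteq> c2" "\<Phi> c1 = \<Phi> c2"
    by (auto simp: inj_on_def)
  define c where "c = (\<lambda>e. int (c1 e) - int (c2 e))"
  have "\<exists>e\<in>E. c e \<noteq> 0"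
  proof (rule ccontr)
    assume "\<not> ?thesis"
    then have "c1 e = c2 e" if "e \<in> E" for e using that by (auto simp: c_def)
    then have "c1 = c2" using c12(1,2) unfolding C_def by (rule PiE_ext[rotated 2])
    with c12(3) show False by simp
  qed
  moreover have "\<bar>\<Sum>e\<in>E. of_int (c e) * Re (g e (\<xi> + of_real v))\<bar> < 1" if v: "\<bar>v\<bar> \<le> R / 2" for v :: real
  proof -
    define t where "t = (\<lambda>j. \<Sum>e\<in>E. of_int (c e) * u e j)"
    define x where "x = v / R"
    have x: "\<bar>x\<bar> \<le> 1 / 2" using v R by (simp add: x_def field_simps abs_if split: if_splits)
    have big: "\<bar>t j\<bar> \<le> real H * real H / 16" for j
      unfolding t_def
    proof (rule lin)
      fix e assume "e \<in> E"
      then have "c1 e \<le> H" "c2 e \<le> H" using c12 by (auto simp: C_def PiE_def Pi_def)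
      then have "\<bar>c e\<bar> \<le> int H" by (auto simp: c_def)
      then show "\<bar>of_int (c e)\<bar> \<le> real H" by linarith
    qed
    have small: "\<bar>t j\<bar> \<le> 1 / 4" if j: "j < M" for j
    proof -
      have "\<lfloor>4 * (\<Sum>e\<in>E. real (c1 e) * u e j)\<rfloor> = \<lfloor>4 * (\<Sum>e\<in>E. real (c2 e) * u e j)\<rfloor>"
        using fun_cong[OF c12(4), of j] j by (simp add: \<Phi>_def)
      then have "\<bar>4 * (\<Sum>e\<in>E. real (c1 e) * u e j) - 4 * (\<Sum>e\<in>E. real (c2 e) * u e j)\<bar> \<le> 1"
        by linarith
      moreover have "t j = (\<Sum>e\<in>E. real (c1 e) * u e j) - (\<Sum>e\<in>E. real (c2 e) * u e j)"
        by (simp add: t_def c_def sum_subtractf left_diff_distrib)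
      ultimately show ?thesis by linarith
    qed
    have "(\<lambda>j. \<Sum>e\<in>E. of_int (c e) * (u e j * x ^ j)) sums (\<Sum>e\<in>E. of_int (c e) * Re (g e (\<xi> + of_real v)))"
      by (intro sums_sum sums_mult) (use expand v in \<open>auto simp: x_def\<close>)
    moreover have "(\<lambda>j. \<Sum>e\<in>E. of_int (c e) * (u e j * x ^ j)) = (\<lambda>j. t j * x ^ j)"
      by (simp add: t_def sum_distrib_right mult.assoc)
    ultimately have sums: "(\<lambda>j. t j * x ^ j) sums (\<Sum>e\<in>E. of_int (c e) * Re (g e (\<xi> + of_real v)))"
      by simp
    have xpow: "\<bar>x\<bar> ^ j \<le> (1/2) ^ j" for j using x by (intro power_mono) auto
    have half: "\<bar>t j * x ^ j\<bar> \<le> K * (1/2) ^ j" if "\<bar>t j\<bar> \<le> K" for j K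
      using that xpow[of j] by (auto simp: abs_mult power_abs intro!: mult_mono)
    \<comment> \<open>The tail from index \<open>M\<close> on is dominated by a geometric series
      with sum \<open>1 / 8\<close>; the head will contribute at most \<open>1 / 2\<close>.\<close>
    have geo: "(\<lambda>i. real H * real H / 16 * (1/2) ^ M * (1/2::real) ^ i) sums (real H * real H / 16 * (1/2) ^ M * 2)"
      using sums_mult[OF geometric_sums[of "1/2::real"], of "real H * real H / 16 * (1/2) ^ M"] by simp
    have tailbd: "\<bar>t (i + M) * x ^ (i + M)\<bar> \<le> real H * real H / 16 * (1/2) ^ M * (1/2) ^ i" for i
      using half[OF big, of "i + M"] by (simp add: power_add mult_ac)
    have tsums: "summable (\<lambda>i. \<bar>t (i + M) * x ^ (i + M)\<bar>)"
      by (rule summable_comparison_test'[OF sums_summable[OF geo]]) (use tailbd in auto)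
    have "\<bar>\<Sum>i. t (i + M) * x ^ (i + M)\<bar> \<le> (\<Sum>i. \<bar>t (i + M) * x ^ (i + M)\<bar>)"
      by (rule summable_rabs[OF tsums])
    also have "\<dots> \<le> (\<Sum>i. real H * real H / 16 * (1/2) ^ M * (1/2) ^ i)"
      by (rule suminf_le[OF _ tsums sums_summable[OF geo]]) (rule tailbd)
    also have "\<dots> = real H * real H / 16 * (1/2) ^ M * 2" using sums_unique[OF geo] by simp
    also have "\<dots> = 1 / 8" using HM Hpos by (simp add: power_divide)
    finally have tail: "\<bar>\<Sum>i. t (i + M) * x ^ (i + M)\<bar> \<le> 1 / 8" .
    have "\<bar>\<Sum>j<M. t j * x ^ j\<bar> \<le> (\<Sum>j<M. \<bar>t j * x ^ j\<bar>)" by (rule sum_abs)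
    also have "\<dots> \<le> (\<Sum>j<M. 1 / 4 * (1/2) ^ j)"
      by (rule sum_mono) (rule half, use small in auto)
    also have "\<dots> = 1 / 4 * (\<Sum>j<M. (1/2) ^ j)" by (simp add: sum_distrib_left)
    also have "\<dots> \<le> 1 / 4 * (\<Sum>j. (1/2) ^ j)"
      by (intro mult_left_mono sum_le_suminf) auto
    also have "\<dots> = 1 / 2" by (subst suminf_geometric) auto
    finally have head: "\<bar>\<Sum>j<M. t j * x ^ j\<bar> \<le> 1 / 2" .
    have "(\<Sum>e\<in>E. of_int (c e) * Re (g e (\<xi> + of_real v)))
        = (\<Sum>i. t (i + M) * x ^ (i + M)) + (\<Sum>j<M. t j * x ^ j)"
      using sums_unique[OF sums] suminf_split_initial_segment[OF sums_summable[OF sums], of M] by simp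
    then show ?thesis using head tail by linarith
  qed
  ultimately show ?thesis by blast
qed

section \<open>Monomials in radicals and their independence over the polynomials\<close>

lemma poly_eq_0_on_interval:
  fixes p :: "real poly"
  assumes "u < v" "\<And>b. u < b \<Longrightarrow> b < v \<Longrightarrow> poly p b = 0"
  shows "p = 0"
proof (rule ccontr)
  assume "p \<noteq> 0"
  then have "finite {b. poly p b = 0}" by (rule poly_roots_finite)
  moreover have "{u<..<v} \<subseteq> {b. poly p b = 0}" using assms by auto
  ultimately have "finite {u<..<v}" by (rule finite_subset[rotated])
  then show False using assms(1) by (simp add: infinite_Ioo)
qed

text \<open>A nonzero shift keeps the branch points \<open>- \<nu> / a\<close> distinct. With shift
  0 all radicals would be constant multiples of \<open>b powr (1 / k)\<close>, and independence
  could fail.\<close>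

locale shifted_radicals =
  fixes S :: "real set" and k :: nat and \<nu> :: real
  assumes finS: "finite S" and pos: "\<And>a. a \<in> S \<Longrightarrow> a > 0" and nu: "\<nu> \<noteq> 0" and k: "k > 0"
begin

definition exponents :: "(real \<Rightarrow> nat) set" where
  "exponents = PiE S (\<lambda>_. {..<k})"

text \<open>On \<open>domain\<close> this is the product of the
  \<open>(a * b + \<nu>) powr (e a / k)\<close>. The form with \<open>exp\<close> keeps it positive
  at every \<open>b\<close> and makes its logarithmic derivative a plain sum.\<close>

definition radmon :: "(real \<Rightarrow> nat) \<Rightarrow> real \<Rightarrow> real" where
  "radmon e b = exp (\<Sum>a\<in>S. real (e a) / real k * ln (a * b + \<nu>))"

definition domain :: "real set" where
  "domain = {b. \<forall>a\<in>S. a * b + \<nu> > 0}"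

lemma finite_exponents [simp]: "finite exponents"
  unfolding exponents_def using finS by (intro finite_PiE) auto

lemma card_exponents: "card exponents = k ^ card S"
  unfolding exponents_def using finS by (simp add: card_PiE)

lemma exponents_less: "e \<in> exponents \<Longrightarrow> a \<in> S \<Longrightarrow> e a < k"
  by (auto simp: exponents_def)

lemma radmon_pos: "radmon e b > 0"
  by (simp add: radmon_def)

lemma radmon_deriv:
  assumes "b \<in> domain"
  shows "(radmon e has_real_derivative
           radmon e b * (\<Sum>a\<in>S. real (e a) / real k * (a / (a * b + \<nu>)))) (at b)"
proof -
  have "((\<lambda>b. \<Sum>a\<in>S. real (e a) / real k * ln (a * b + \<nu>)) has_real_derivative
          (\<Sum>a\<in>S. real (e a) / real k * (a / (a * b + \<nu>)))) (at b)"
  proof (rule DERIV_sum)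
    fix a assume "a \<in> S"
    then have "a * b + \<nu> > 0" using assms by (auto simp: domain_def)
    then show "((\<lambda>b. real (e a) / real k * ln (a * b + \<nu>)) has_real_derivative
          real (e a) / real k * (a / (a * b + \<nu>))) (at b)"
      using k by (auto intro!: derivative_eq_intros simp: ac_simps)
  qed
  then have "((\<lambda>b. exp (\<Sum>a\<in>S. real (e a) / real k * ln (a * b + \<nu>))) has_real_derivative
          exp (\<Sum>a\<in>S. real (e a) / real k * ln (a * b + \<nu>)) *
          (\<Sum>a\<in>S. real (e a) / real k * (a / (a * b + \<nu>)))) (at b)"
    by (rule DERIV_fun_exp)
  then show ?thesis by (simp add: radmon_def[abs_def])
qed

text \<open>The logarithmic derivative of a quotient of two polynomials has integral residues, whereas
  that of \<open>radmon e0 / radmon e\<close> has residue \<open>(e0 a - e a) / k\<close> at \<open>- \<nu> / a\<close>.\<close>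

lemma exponents_eq_if_log_derivative:
  assumes "e \<in> exponents" "e0 \<in> exponents" "P \<noteq> 0" "Q \<noteq> 0"
    and eq: "(pderiv P * Q - P * pderiv Q) * (\<Prod>a\<in>S. [:\<nu>, a:])
      + P * Q * (\<Sum>a\<in>S. smult ((real (e a) - real (e0 a)) / real k * a)
                   (\<Prod>a'\<in>S - {a}. [:\<nu>, a':])) = 0"
  shows "e = e0"
proof -
  have "e a = e0 a" if a: "a \<in> S" for a
  proof -
    define r where "r = - \<nu> / a"
    define U where "U = smult a (\<Prod>a'\<in>S - {a}. [:\<nu>, a':])"
    define V where "V = (\<Sum>a\<in>S. smult ((real (e a) - real (e0 a)) / real k * a)
                   (\<Prod>a'\<in>S - {a}. [:\<nu>, a':]))"
    have a0: "a > 0" using pos a by auto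
    have lin: "[:\<nu>, a:] = smult a [:- r, 1:]" using a0 by (simp add: r_def)
    then have prod: "(\<Prod>a\<in>S. [:\<nu>, a:]) = [:- r, 1:] * U"
      by (simp only: prod.remove[OF finS a] lin U_def mult_smult_left mult_smult_right)
    \<comment> \<open>Since \<open>\<nu> \<noteq> 0\<close>, the branch point \<open>r\<close> is a
      root of no other linear factor.\<close>
    have root: "\<nu> + r * a' = 0 \<longleftrightarrow> a' = a" for a'
    proof -
      have "\<nu> + r * a' = \<nu> * (a - a') / a" using a0 by (simp add: r_def field_simps)
      then show ?thesis using nu a0 by auto
    qed
    have Ur: "poly U r \<noteq> 0"
      using a0 finS by (simp add: U_def poly_prod root)
    have "poly V r = (\<Sum>a''\<in>S. (real (e a'') - real (e0 a'')) / real k * a'' *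
                   (\<Prod>a'\<in>S - {a''}. \<nu> + r * a'))"
      by (simp add: V_def poly_sum poly_prod)
    \<comment> \<open>Every summand of \<open>V\<close> other than that of \<open>a\<close> still
      contains the linear factor of \<open>a\<close>, which vanishes at \<open>r\<close>.\<close>
    also have "\<dots> = (\<Sum>a''\<in>S. if a'' = a then (real (e a) - real (e0 a)) / real k * poly U r else 0)"
    proof (rule sum.cong[OF refl], goal_cases)
      case (1 a'')
      show ?case
      proof (cases "a'' = a")
        case True
        then show ?thesis by (simp add: U_def poly_prod)
      next
        case False
        then have "(\<Prod>a'\<in>S - {a''}. \<nu> + r * a') = 0"
          using finS a root by (intro prod_zero) auto
        then show ?thesis using False by simp
      qed
    qed
    also have "\<dots> = (real (e a) - real (e0 a)) / real k * poly U r"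
      using a finS by simp
    finally have Vr: "poly V r = (real (e a) - real (e0 a)) / real k * poly U r" .
    have "(of_nat (order r P) - of_nat (order r Q)) * poly U r + poly V r = 0"
      using order_log_derivative[OF assms(3,4), of r U V] eq Ur unfolding prod V_def by blast
    then have "(of_nat (order r P) - of_nat (order r Q) + (real (e a) - real (e0 a)) / real k) * poly U r = 0"
      by (simp add: Vr algebra_simps)
    then have "of_nat (order r P) - of_nat (order r Q) + (real (e a) - real (e0 a)) / real k = 0"
      using Ur by simp
    then have "real k * (of_nat (order r P) - of_nat (order r Q)) + (real (e a) - real (e0 a)) = 0"
      using k by (simp add: field_simps)
    \<comment> \<open>Back in the integers, \<open>k\<close> divides the difference of two exponents
      that are both below \<open>k\<close>, so they agree.\<close>
    then have "of_int (int k * (int (order r P) - int (order r Q)) + (int (e a) - int (e0 a))) = (0::real)"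
      by simp
    then have *: "int k * (int (order r P) - int (order r Q)) + (int (e a) - int (e0 a)) = 0"
      by linarith
    then have "int k dvd int (e0 a) - int (e a)" by (intro dvdI[of _ _ "int (order r P) - int (order r Q)"]) simp
    moreover have "e a < k" "e0 a < k" using assms exponents_less a by auto
    ultimately show ?thesis using zdvd_not_zless[of "\<bar>int (e0 a) - int (e a)\<bar>" "int k"] by force
  qed
  then show ?thesis
    using assms(1,2) unfolding exponents_def by (rule PiE_ext[rotated 2])
qed

text \<open>If \<open>p e0\<close> is nonzero, divide the relation by
  \<open>p e0 * radmon e0\<close> and differentiate: the term of \<open>e0\<close> disappears, and
  the induction hypothesis makes all new coefficients vanish. A nonzero \<open>p e\<close> would
  then give the relation excluded by \<open>exponents_eq_if_log_derivative\<close>, so only the term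
  of \<open>e0\<close> is left.\<close>

lemma radmon_independent:
  assumes "finite T" "T \<subseteq> exponents" "u < v" "{u<..<v} \<subseteq> domain"
    and "\<And>b. u < b \<Longrightarrow> b < v \<Longrightarrow> (\<Sum>e\<in>T. poly (p e) b * radmon e b) = 0"
    and "e \<in> T"
  shows "p e = 0"
  using assms
proof (induction T arbitrary: p e rule: finite_induct)
  case empty
  then show ?case by simp
next
  case (insert e0 T)
  have reduce: "p e = 0" if "e \<in> T" "p e0 = 0" for e
    using insert.IH[of p e] insert.prems that insert.hyps by (simp del: greaterThanLessThan_iff)
  show ?case
  proof (cases "p e0 = 0")
    case True
    then show ?thesis using insert.prems reduce by auto
  next
    case False
    define W where "W = (\<Prod>a\<in>S. [:\<nu>, a:])"
    define V where "V = (\<lambda>e. \<Sum>a\<in>S. smult ((real (e a) - real (e0 a)) / real k * a)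
                   (\<Prod>a'\<in>S - {a}. [:\<nu>, a':]))"
    define \<omega> where "\<omega> = (\<lambda>e b. \<Sum>a\<in>S. real (e a) / real k * (a / (a * b + \<nu>)))"
    \<comment> \<open>Up to the factor \<open>W * p e0 * p e0\<close>, this is the coefficient of
      \<open>radmon e / radmon e0\<close> in the derivative of
      \<open>p e / p e0 * (radmon e / radmon e0)\<close>; \<open>W\<close> clears the denominators
      \<open>a * b + \<nu>\<close>.\<close>
    define q where "q = (\<lambda>e. (pderiv (p e) * p e0 - p e * pderiv (p e0)) * W + p e * p e0 * V e)"
    have "(\<Sum>e\<in>T. poly (q e) b * radmon e b) = 0" if b: "u < b" "b < v" for b
    proof -
      have bd: "b \<in> domain" using insert.prems b by auto
      have V: "poly (V e) b = (\<omega> e b - \<omega> e0 b) * poly W b" for e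
      proof -
        have "poly (V e) b = (\<Sum>a\<in>S. (real (e a) - real (e0 a)) / real k * a *
                   (\<Prod>a'\<in>S - {a}. \<nu> + b * a'))"
          by (simp add: V_def poly_sum poly_prod)
        also have "\<dots> = (\<Sum>a\<in>S. (real (e a) / real k * (a / (a * b + \<nu>))
            - real (e0 a) / real k * (a / (a * b + \<nu>))) * poly W b)"
        proof (rule sum.cong[OF refl], goal_cases)
          case (1 a)
          have "poly W b = (\<Prod>a\<in>S. \<nu> + b * a)" by (simp add: W_def poly_prod)
          also have "\<dots> = (\<nu> + b * a) * (\<Prod>a'\<in>S - {a}. \<nu> + b * a')"
            by (rule prod.remove[OF finS 1])
          finally have "poly W b = (\<nu> + b * a) * (\<Prod>a'\<in>S - {a}. \<nu> + b * a')" .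
          moreover have "a * b + \<nu> > 0" using bd 1 by (auto simp: domain_def)
          then have "\<nu> + b * a \<noteq> 0" by (simp add: ac_simps)
          then have "(x - y) / z * a * w =
              (x / z * (a / (\<nu> + b * a)) - y / z * (a / (\<nu> + b * a))) * ((\<nu> + b * a) * w)" for x y z w
            by (simp add: diff_divide_distrib left_diff_distrib)
          ultimately show ?case by (simp only: add.commute[of _ \<nu>] mult.commute[of a b])
        qed
        also have "\<dots> = (\<omega> e b - \<omega> e0 b) * poly W b"
          by (simp add: \<omega>_def sum_distrib_right sum_subtractf left_diff_distrib)
        finally show ?thesis .
      qed
      have "((\<lambda>b. \<Sum>e\<in>insert e0 T. poly (p e) b * radmon e b) has_real_derivative
          (\<Sum>e\<in>insert e0 T. poly (p e) b * (radmon e b * \<omega> e b) + poly (pderiv (p e)) b * radmon e b)) (at b)"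
        by (rule DERIV_sum, rule DERIV_mult'[OF poly_DERIV])
           (use radmon_deriv[OF bd] in \<open>simp add: \<omega>_def\<close>)
      moreover have "((\<lambda>b. \<Sum>e\<in>insert e0 T. poly (p e) b * radmon e b) has_real_derivative 0) (at b)"
        using insert.prems(4) b by (intro has_field_derivative_transform_within_open[OF DERIV_const, where S="{u<..<v}"]) (auto simp del: sum.insert)
      ultimately have D: "(\<Sum>e\<in>insert e0 T. poly (p e) b * (radmon e b * \<omega> e b) + poly (pderiv (p e)) b * radmon e b) = 0"
        by (rule DERIV_unique)
      have R: "(\<Sum>e\<in>insert e0 T. poly (p e) b * radmon e b) = 0"
        using insert.prems b by blast
      have "(\<Sum>e\<in>T. poly (q e) b * radmon e b) = (\<Sum>e\<in>insert e0 T. poly (q e) b * radmon e b)"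
        using insert.hyps by (simp add: q_def V_def)
      \<comment> \<open>The quotient rule without division: a multiple of the differentiated
        relation minus a multiple of the original one.\<close>
      also have "\<dots> = (\<Sum>e\<in>insert e0 T. poly W b * poly (p e0) b *
            (poly (p e) b * (radmon e b * \<omega> e b) + poly (pderiv (p e)) b * radmon e b)
          - poly W b * (poly (pderiv (p e0)) b + poly (p e0) b * \<omega> e0 b) * (poly (p e) b * radmon e b))"
        by (rule sum.cong[OF refl]) (simp add: q_def V algebra_simps)
      also have "\<dots> = 0" unfolding sum_subtractf
        by (simp only: sum_distrib_left[symmetric] D R)
      finally show ?thesis .
    qed
    then have q0: "q e = 0" if "e \<in> T" for e
      using insert.IH[of q e] insert.prems that by (simp del: greaterThanLessThan_iff)
    have pT: "p e = 0" if e: "e \<in> T" for e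
    proof (rule ccontr)
      assume "p e \<noteq> 0"
      then have "e = e0"
        using exponents_eq_if_log_derivative[of e e0 "p e" "p e0"] q0[OF e] False insert.prems e
        by (auto simp: q_def V_def W_def)
      then show False using e insert.hyps by auto
    qed
    have "poly (p e0) b = 0" if "u < b" "b < v" for b
      using insert.prems(4)[OF that] insert.hyps pT radmon_pos[of e0 b] by simp
    then have "p e0 = 0" using poly_eq_0_on_interval insert.prems by blast
    with False show ?thesis by simp
  qed
qed

section \<open>Products of the monomials and zeros of their combinations\<close>

text \<open>When two exponents below \<open>k\<close> add up to at least \<open>k\<close>, the
  excess is one full power of \<open>a * b + \<nu>\<close>, which is a polynomial factor.\<close>

definition carry :: "(real \<Rightarrow> nat) \<Rightarrow> (real \<Rightarrow> nat) \<Rightarrow> real poly" where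
  "carry e e' = (\<Prod>a\<in>S. if k \<le> e a + e' a then [:\<nu>, a:] else 1)"

definition add_mod :: "(real \<Rightarrow> nat) \<Rightarrow> (real \<Rightarrow> nat) \<Rightarrow> real \<Rightarrow> nat" where
  "add_mod e e' = restrict (\<lambda>a. (e a + e' a) mod k) S"

lemma add_mod_exponents: "add_mod e e' \<in> exponents"
  using k by (auto simp: add_mod_def exponents_def)

lemma degree_carry: "degree (carry e e') \<le> card S"
proof -
  have "degree (carry e e') \<le> (\<Sum>a\<in>S. 1)"
    unfolding carry_def
    by (rule order_trans[OF degree_prod_sum_le[OF finS] sum_mono]) auto
  then show ?thesis by simp
qed

lemma radmon_mult:
  assumes "e \<in> exponents" "e' \<in> exponents" "b \<in> domain"
  shows "radmon e b * radmon e' b = poly (carry e e') b * radmon (add_mod e e') b"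
proof -
  have radmon: "radmon e b = (\<Prod>a\<in>S. exp (real (e a) / real k * ln (a * b + \<nu>)))" for e
    unfolding radmon_def by (rule exp_sum[OF finS])
  have "exp (real (e a) / real k * ln (a * b + \<nu>)) * exp (real (e' a) / real k * ln (a * b + \<nu>))
      = poly (if k \<le> e a + e' a then [:\<nu>, a:] else 1) b
        * exp (real (add_mod e e' a) / real k * ln (a * b + \<nu>))" if a: "a \<in> S" for a
  proof (cases "k \<le> e a + e' a")
    case True
    have l: "a * b + \<nu> > 0" using assms(3) a by (auto simp: domain_def)
    have "e a < k" "e' a < k" using assms exponents_less a by auto
    then have "(e a + e' a) mod k = e a + e' a - k" using True
      by (simp add: mod_if le_mod_geq)
    then have "real (add_mod e e' a) = real (e a) + real (e' a) - real k"
      using True a by (simp add: add_mod_def)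
    then have "real (e a) + real (e' a) = real k + real (add_mod e e' a)" by simp
    then have "(real (e a) + real (e' a)) / real k * ln (a * b + \<nu>)
        = (real k + real (add_mod e e' a)) / real k * ln (a * b + \<nu>)" by simp
    then have "real (e a) / real k * ln (a * b + \<nu>) + real (e' a) / real k * ln (a * b + \<nu>)
        = ln (a * b + \<nu>) + real (add_mod e e' a) / real k * ln (a * b + \<nu>)"
      using k by (simp add: add_divide_distrib distrib_right)
    then have "exp (real (e a) / real k * ln (a * b + \<nu>)) * exp (real (e' a) / real k * ln (a * b + \<nu>))
        = exp (ln (a * b + \<nu>)) * exp (real (add_mod e e' a) / real k * ln (a * b + \<nu>))"
      by (simp only: exp_add[symmetric])
    then show ?thesis using True l by (simp add: ac_simps)
  next
    case False
    then show ?thesis using a by (simp add: add_mod_def exp_add[symmetric] add_divide_distrib algebra_simps)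
  qed
  then have "(\<Prod>a\<in>S. exp (real (e a) / real k * ln (a * b + \<nu>)) * exp (real (e' a) / real k * ln (a * b + \<nu>)))
      = (\<Prod>a\<in>S. poly (if k \<le> e a + e' a then [:\<nu>, a:] else 1) b
        * exp (real (add_mod e e' a) / real k * ln (a * b + \<nu>)))"
    by (intro prod.cong) auto
  then show ?thesis by (simp only: radmon carry_def poly_prod prod.distrib)
qed

lemma domain_interval: "\<exists>u. {u<..<u+1} \<subseteq> domain"
proof (cases "S = {}")
  case True
  then show ?thesis unfolding domain_def by simp
next
  case False
  define u where "u = Max ((\<lambda>a. - \<nu> / a) ` S)"
  have "a * b + \<nu> > 0" if "a \<in> S" "b > u" for a b
  proof -
    have "- \<nu> / a \<le> u" unfolding u_def using that finS by (intro Max_ge) auto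
    then have "- \<nu> / a < b" using that by simp
    then show ?thesis using pos[OF that(1)] by (simp add: field_simps)
  qed
  then show ?thesis by (intro exI[of _ u]) (auto simp: domain_def)
qed

text \<open>Counting coefficients yields polynomials \<open>G e\<close>, \<open>P\<close>, not all zero, with
  \<open>F * (\<Sum>e. G e * radmon e) + P = 0\<close>, where \<open>F\<close> is the given combination; independence forces \<open>P \<noteq> 0\<close>.\<close>

lemma radmon_combination_zeros:
  fixes c :: "(real \<Rightarrow> nat) \<Rightarrow> real"
  assumes c: "\<exists>e\<in>exponents. c e \<noteq> 0"
  shows "finite {b \<in> domain. (\<Sum>e\<in>exponents. c e * radmon e b) = 0}"
    and "card {b \<in> domain. (\<Sum>e\<in>exponents. c e * radmon e b) = 0} \<le> card S * k ^ card S"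
proof -
  define q where "q = k ^ card S"
  \<comment> \<open>Degrees are chosen for the count: there are \<open>q * (d + 1)\<close> unknowns
    for the \<open>G e\<close> and \<open>D + 1\<close> for \<open>P\<close>, against
    \<open>q * (D + 1) = q * (d + 1) + D\<close> equations, so exactly one unknown is to
    spare.\<close>
  define D where "D = card S * q"
  define d where "d = D - card S"
  define F where "F = (\<lambda>b. \<Sum>e\<in>exponents. c e * radmon e b)"
  define z where "z = restrict (\<lambda>_::real. 0::nat) S"
  have z: "z \<in> exponents" using k by (auto simp: z_def exponents_def)
  have radz: "radmon z b = 1" for b
    by (simp add: radmon_def z_def)
  have q: "q \<ge> 1" using k by (simp add: q_def)
  have dD: "d + card S = D" using q by (simp add: d_def D_def)
  define I where "I = (exponents \<times> {..d}) <+> {..D}"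
  define J where "J = exponents \<times> {..D}"
  \<comment> \<open>\<open>col i e1\<close> is the polynomial in front of \<open>radmon e1\<close>
    contributed by the unknown \<open>i\<close>: for \<open>Inl (e, j)\<close> it comes from
    \<open>b ^ j * radmon e b * F b\<close>, expanded by \<open>radmon_mult\<close>, and for
    \<open>Inr j\<close> from \<open>b ^ j\<close> alone.\<close>
  define col where "col = (\<lambda>i e1. case i of
      Inl (e, j) \<Rightarrow> (\<Sum>e'\<in>exponents. if add_mod e' e = e1 then smult (c e') (carry e' e * monom 1 j) else 0)
    | Inr j \<Rightarrow> if e1 = z then monom (1::real) j else 0)"
  have finI: "finite I" "finite J" by (simp_all add: I_def J_def)
  have "card J = q * (D + 1)" by (simp add: J_def card_cartesian_product card_exponents q_def)
  moreover have "card I = q * (d + 1) + (D + 1)"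
    by (simp add: I_def card_Plus card_cartesian_product card_exponents q_def)
  moreover have "q * (D + 1) = q * (d + 1) + D"
    unfolding dD[symmetric] by (simp add: algebra_simps) (simp add: dD D_def)
  ultimately have "card J < card I" by simp
  then obtain w where w: "\<exists>i\<in>I. w i \<noteq> (0::real)"
    "\<And>e1 j1. e1 \<in> exponents \<Longrightarrow> j1 \<le> D \<Longrightarrow> (\<Sum>i\<in>I. coeff (col i e1) j1 * w i) = 0"
    using homogeneous_system_solution[OF finI(2,1), of "\<lambda>(e1, j1) i. coeff (col i e1) j1"]
    by (auto simp: J_def)
  have degcol: "degree (col i e1) \<le> D" if i: "i \<in> I" for i e1
  proof (cases i)
    case (Inl p)
    obtain e j where p: "p = (e, j)" by force
    have j: "j \<le> d" using i Inl p by (auto simp: I_def)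
    have "degree (smult (c e') (carry e' e * monom 1 j)) \<le> D" for e'
    proof -
      have "degree (smult (c e') (carry e' e * monom 1 j)) \<le> degree (carry e' e * monom 1 j)"
        by (rule degree_smult_le)
      also have "\<dots> \<le> degree (carry e' e) + degree (monom (1::real) j)" by (rule degree_mult_le)
      also have "\<dots> \<le> card S + d"
        using degree_carry[of e' e] degree_monom_le[of "1::real" j] j by linarith
      finally show ?thesis using dD by simp
    qed
    then show ?thesis unfolding col_def Inl p by (auto intro!: degree_sum_le)
  next
    case (Inr j)
    then show ?thesis using i by (auto simp: col_def I_def degree_monom_eq)
  qed
  have zero: "(\<Sum>i\<in>I. smult (w i) (col i e1)) = 0" if e1: "e1 \<in> exponents" for e1
  proof (rule poly_eqI)
    fix j1
    show "coeff (\<Sum>i\<in>I. smult (w i) (col i e1)) j1 = coeff 0 j1"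
    proof (cases "j1 \<le> D")
      case True
      then show ?thesis using w(2)[OF e1 True] by (simp add: coeff_sum mult.commute)
    next
      case False
      then have "coeff (col i e1) j1 = 0" if "i \<in> I" for i
        using degcol[OF that, of e1] by (intro coeff_eq_0) simp
      then show ?thesis by (simp add: coeff_sum)
    qed
  qed
  define G where "G = (\<lambda>e. \<Sum>j\<le>d. monom (w (Inl (e, j))) j)"
  define P where "P = (\<Sum>j\<le>D. monom (w (Inr j)) j)"
  have colInl: "(\<Sum>e1\<in>exponents. poly (col (Inl (e, j)) e1) b * radmon e1 b) = b ^ j * radmon e b * F b"
    if e: "e \<in> exponents" and b: "b \<in> domain" for e j b
  proof -
    have "(\<Sum>e1\<in>exponents. poly (col (Inl (e, j)) e1) b * radmon e1 b)
      = (\<Sum>e1\<in>exponents. \<Sum>e'\<in>exponents. if e1 = add_mod e' e then c e' * poly (carry e' e) b * b ^ j * radmon e1 b else 0)"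
      unfolding col_def sum.case prod.case poly_sum sum_distrib_right
      by (intro sum.cong) (auto simp: poly_monom)
    also have "\<dots> = (\<Sum>e'\<in>exponents. \<Sum>e1\<in>exponents. if e1 = add_mod e' e then c e' * poly (carry e' e) b * b ^ j * radmon e1 b else 0)"
      by (rule sum.swap)
    also have "\<dots> = (\<Sum>e'\<in>exponents. c e' * b ^ j * (radmon e' b * radmon e b))"
    proof (rule sum.cong[OF refl], goal_cases)
      case (1 e')
      have "(\<Sum>e1\<in>exponents. if e1 = add_mod e' e then c e' * poly (carry e' e) b * b ^ j * radmon e1 b else 0)
          = c e' * poly (carry e' e) b * b ^ j * radmon (add_mod e' e) b"
        using add_mod_exponents by simp
      then show ?case by (simp add: radmon_mult[OF 1 e b])
    qed
    also have "\<dots> = b ^ j * radmon e b * F b"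
      by (simp add: F_def sum_distrib_left mult_ac)
    finally show ?thesis .
  qed
  have rel: "F b * (\<Sum>e\<in>exponents. poly (G e) b * radmon e b) + poly P b = 0" if b: "b \<in> domain" for b
  proof -
    have "0 = (\<Sum>e1\<in>exponents. poly (\<Sum>i\<in>I. smult (w i) (col i e1)) b * radmon e1 b)"
      by (simp add: zero)
    also have "\<dots> = (\<Sum>e1\<in>exponents. \<Sum>i\<in>I. w i * (poly (col i e1) b * radmon e1 b))"
      by (simp add: poly_sum sum_distrib_right mult.assoc)
    also have "\<dots> = (\<Sum>i\<in>I. w i * (\<Sum>e1\<in>exponents. poly (col i e1) b * radmon e1 b))"
      by (subst sum.swap) (simp add: sum_distrib_left)
    also have "\<dots> = (\<Sum>p\<in>exponents \<times> {..d}. w (Inl p) * (\<Sum>e1\<in>exponents. poly (col (Inl p) e1) b * radmon e1 b))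
        + (\<Sum>j\<le>D. w (Inr j) * (\<Sum>e1\<in>exponents. poly (col (Inr j) e1) b * radmon e1 b))"
      unfolding I_def by (subst sum.Plus) (auto simp: o_def)
    also have "(\<Sum>p\<in>exponents \<times> {..d}. w (Inl p) * (\<Sum>e1\<in>exponents. poly (col (Inl p) e1) b * radmon e1 b))
        = (\<Sum>e\<in>exponents. \<Sum>j\<le>d. w (Inl (e, j)) * (\<Sum>e1\<in>exponents. poly (col (Inl (e, j)) e1) b * radmon e1 b))"
      by (subst sum.cartesian_product) (simp add: case_prod_unfold)
    also have "\<dots> = (\<Sum>e\<in>exponents. \<Sum>j\<le>d. w (Inl (e, j)) * (b ^ j * radmon e b * F b))"
      by (intro sum.cong refl) (simp add: colInl b)
    also have "\<dots> = F b * (\<Sum>e\<in>exponents. poly (G e) b * radmon e b)"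
      by (simp add: G_def poly_sum poly_monom sum_distrib_left sum_distrib_right mult_ac)
    also have "(\<Sum>j\<le>D. w (Inr j) * (\<Sum>e1\<in>exponents. poly (col (Inr j) e1) b * radmon e1 b)) = poly P b"
    proof -
      have "(\<Sum>e1\<in>exponents. poly (col (Inr j) e1) b * radmon e1 b) = b ^ j" for j
      proof -
        have "(\<Sum>e1\<in>exponents. poly (col (Inr j) e1) b * radmon e1 b)
            = (\<Sum>e1\<in>exponents. if e1 = z then b ^ j else 0)"
          by (intro sum.cong) (auto simp: col_def poly_monom radz)
        then show ?thesis using z by simp
      qed
      then show ?thesis by (simp add: P_def poly_sum poly_monom)
    qed
    finally show ?thesis by simp
  qed
  \<comment> \<open>By independence \<open>F\<close> is nonzero somewhere to the right of the branch
    points, hence on an interval by continuity. If \<open>P\<close> were 0, the other factor would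
    vanish there, and a second use of independence would make all unknowns 0.\<close>
  have "P \<noteq> 0"
  proof
    assume P0: "P = 0"
    have coeffP: "coeff P j = w (Inr j)" if "j \<le> D" for j
      using that by (simp add: P_def coeff_sum)
    obtain u where u: "{u<..<u+1} \<subseteq> domain" using domain_interval by auto
    have "\<exists>b\<in>{u<..<u+1}. F b \<noteq> 0"
    proof (rule ccontr)
      assume "\<not> ?thesis"
      then have "(\<Sum>e\<in>exponents. poly [:c e:] b * radmon e b) = 0" if "u < b" "b < u+1" for b
        using that by (simp add: F_def)
      then have "[:c e:] = 0" if "e \<in> exponents" for e
        using radmon_independent[of exponents u "u+1" "\<lambda>e. [:c e:]" e] u that by auto
      with c show False by auto
    qed
    then obtain b0 where b0: "b0 \<in> {u<..<u+1}" "F b0 \<noteq> 0" by auto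
    have "isCont (radmon e) b" if "b \<in> domain" for e b
      using radmon_deriv[OF that] by (rule DERIV_isCont)
    then have "continuous_on {u<..<u+1} F"
      unfolding F_def using u by (intro continuous_intros continuous_at_imp_continuous_on) auto
    then have "open ({u<..<u+1} \<inter> F -` (- {0}))"
      by (intro continuous_open_preimage) auto
    moreover have "b0 \<in> {u<..<u+1} \<inter> F -` (- {0})" using b0 by simp
    ultimately obtain \<epsilon> where eps: "\<epsilon> > 0" "ball b0 \<epsilon> \<subseteq> {u<..<u+1} \<inter> F -` (- {0})"
      unfolding open_contains_ball by blast
    have inball: "b \<in> {u<..<u+1} \<inter> F -` (- {0})" if "b0 - \<epsilon> < b" "b < b0 + \<epsilon>" for b
      using eps(2) that by (auto simp: dist_real_def subset_iff)
    have "(\<Sum>e\<in>exponents. poly (G e) b * radmon e b) = 0" if "b0 - \<epsilon> < b" "b < b0 + \<epsilon>" for b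
      using rel[of b] inball[OF that] u P0 by (auto simp del: greaterThanLessThan_iff)
    then have G0: "G e = 0" if "e \<in> exponents" for e
      using radmon_independent[of exponents "b0 - \<epsilon>" "b0 + \<epsilon>" G e] that eps(1) inball u by force
    have coeffG: "coeff (G e) j = w (Inl (e, j))" if "j \<le> d" for e j
      using that by (simp add: G_def coeff_sum)
    show False using w(1) coeffG coeffP G0 P0 by (auto simp: I_def) (metis coeff_0)+
  qed
  have sub: "{b \<in> domain. F b = 0} \<subseteq> {b. poly P b = 0}"
  proof (intro subsetI CollectI)
    fix b assume "b \<in> {b \<in> domain. F b = 0}"
    then show "poly P b = 0" using rel[of b] by simp
  qed
  have finP: "finite {b. poly P b = 0}" using \<open>P \<noteq> 0\<close> by (rule poly_roots_finite)
  show "finite {b \<in> domain. (\<Sum>e\<in>exponents. c e * radmon e b) = 0}"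
    using finite_subset[OF sub finP] by (simp add: F_def)
  have "card {b \<in> domain. F b = 0} \<le> card {b. poly P b = 0}" by (rule card_mono[OF finP sub])
  also have "\<dots> \<le> degree P" using \<open>P \<noteq> 0\<close> by (rule card_poly_roots_bound)
  also have "\<dots> \<le> D" unfolding P_def
    by (intro degree_sum_le) (auto intro: order_trans[OF degree_monom_le])
  finally show "card {b \<in> domain. (\<Sum>e\<in>exponents. c e * radmon e b) = 0} \<le> card S * k ^ card S"
    by (simp add: F_def D_def q_def)
qed

section \<open>Holomorphic continuation and points with integral radicals\<close>

definition cradmon :: "(real \<Rightarrow> nat) \<Rightarrow> complex \<Rightarrow> complex" where
  "cradmon e z = exp (\<Sum>a\<in>S. of_real (real (e a) / real k) * Ln (of_real a * z + of_real \<nu>))"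

lemma cradmon_holomorphic:
  assumes "\<And>z a. z \<in> U \<Longrightarrow> a \<in> S \<Longrightarrow> 0 < a * Re z + \<nu>"
  shows "cradmon e holomorphic_on U"
proof -
  have "of_real a * z + of_real \<nu> \<notin> \<real>\<^sub>\<le>\<^sub>0" if "z \<in> U" "a \<in> S" for a and z :: complex
    using assms[OF that] by (auto simp: complex_nonpos_Reals_iff)
  then show ?thesis unfolding cradmon_def[abs_def]
    by (intro holomorphic_intros) auto
qed

lemma cradmon_of_real:
  assumes "b \<in> domain"
  shows "cradmon e (of_real b) = of_real (radmon e b)"
proof -
  have "Ln (of_real a * of_real b + of_real \<nu>) = of_real (ln (a * b + \<nu>))" if "a \<in> S" for a
    using assms that Ln_of_real[of "a * b + \<nu>"] by (auto simp: domain_def)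
  then show ?thesis by (simp add: cradmon_def radmon_def flip: exp_of_real)
qed

text \<open>The exponents \<open>e a / k\<close> lie below 1 and \<open>ln C \<ge> 0\<close>, so
  each of the \<open>card S\<close> factors has modulus at most \<open>C\<close>.\<close>

lemma norm_cradmon_le:
  assumes e: "e \<in> exponents" and pos: "\<And>a. a \<in> S \<Longrightarrow> 0 < a * Re z + \<nu>"
    and le: "\<And>a. a \<in> S \<Longrightarrow> norm (of_real a * z + of_real \<nu>) \<le> C" and C: "C \<ge> 1"
  shows "norm (cradmon e z) \<le> C ^ card S"
proof -
  have "Re (of_real (real (e a) / real k) * Ln (of_real a * z + of_real \<nu>)) \<le> ln C" if a: "a \<in> S" for a
  proof -
    have "Re (of_real a * z + of_real \<nu>) > 0" using pos[OF a] by simp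
    then have nz: "of_real a * z + of_real \<nu> \<noteq> 0" by (metis zero_complex.sel(1) less_irrefl)
    have "ln (norm (of_real a * z + of_real \<nu>)) \<le> ln C"
      using le[OF a] nz C by (subst ln_le_cancel_iff) auto
    then have "real (e a) / real k * ln (norm (of_real a * z + of_real \<nu>)) \<le> real (e a) / real k * ln C"
      by (intro mult_left_mono) auto
    also have "\<dots> \<le> 1 * ln C"
      using exponents_less[OF e a] C by (intro mult_right_mono) (auto simp: divide_le_eq)
    finally show ?thesis using nz by (simp add: Re_Ln)
  qed
  then have "Re (\<Sum>a\<in>S. of_real (real (e a) / real k) * Ln (of_real a * z + of_real \<nu>)) \<le> (\<Sum>a\<in>S. ln C)"
    unfolding Re_sum by (intro sum_mono)
  then have "norm (cradmon e z) \<le> exp (real (card S) * ln C)" by (simp add: cradmon_def)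
  also have "\<dots> = C ^ card S" using C by (simp add: exp_of_nat_mult)
  finally show ?thesis .
qed

definition power_point :: "real \<Rightarrow> bool" where
  "power_point b \<longleftrightarrow> (\<forall>a\<in>S. \<exists>y::nat. y \<ge> 1 \<and> a * b + \<nu> = real y ^ k)"

lemma power_point_domain: "power_point b \<Longrightarrow> b \<in> domain"
  by (force simp: power_point_def domain_def)

text \<open>The radicals are the natural numbers \<open>y a\<close> themselves. This integrality
  turns the bound below 1 for a combination into its vanishing.\<close>

lemma radmon_integer:
  assumes "power_point b"
  shows "radmon e b \<in> \<int>"
proof -
  obtain y :: "real \<Rightarrow> nat" where y: "\<And>a. a \<in> S \<Longrightarrow> y a \<ge> 1" "\<And>a. a \<in> S \<Longrightarrow> a * b + \<nu> = real (y a) ^ k"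
    using assms unfolding power_point_def by metis
  have "radmon e b = (\<Prod>a\<in>S. exp (real (e a) / real k * ln (a * b + \<nu>)))"
    unfolding radmon_def by (rule exp_sum[OF finS])
  also have "\<dots> = (\<Prod>a\<in>S. real (y a ^ e a))"
  proof (rule prod.cong[OF refl], goal_cases)
    case (1 a)
    have "real (e a) / real k * ln (a * b + \<nu>) = real (e a) * ln (real (y a))"
      using y[OF 1] k by (simp add: ln_realpow)
    then show ?case using y(1)[OF 1] by (simp add: exp_of_nat_mult)
  qed
  also have "\<dots> = of_nat (\<Prod>a\<in>S. y a ^ e a)" by simp
  finally show ?thesis by (metis Ints_of_nat)
qed

text \<open>Half of the disc of radius \<open>r\<close> around \<open>u + 3 r / 2\<close> covers \<open>{u + r..u + 2 * r}\<close>, and the whole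
  disc avoids all branch points, the rightmost of which is \<open>u\<close>.\<close>

lemma power_points_dyadic:
  fixes X r :: real and h :: nat
  defines "u \<equiv> Max ((\<lambda>a. - \<nu> / a) ` S)"
  assumes S: "S \<noteq> {}" "\<And>a. a \<in> S \<Longrightarrow> 1 \<le> a" "\<And>a. a \<in> S \<Longrightarrow> a \<le> X"
    and X: "\<bar>\<nu>\<bar> \<le> X" and r: "0 < r" "r \<le> 2 * X"
    and h: "16 * real (k ^ card S) * (7 * X\<^sup>2) ^ card S \<le> 2 ^ h" "4 * h + 2 \<le> k ^ card S"
  shows "finite {b. u + r \<le> b \<and> b \<le> u + 2 * r \<and> power_point b}"
    and "card {b. u + r \<le> b \<and> b \<le> u + 2 * r \<and> power_point b} \<le> card S * k ^ card S"
proof -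
  define Z where "Z = {b. u + r \<le> b \<and> b \<le> u + 2 * r \<and> power_point b}"
  have X1: "X \<ge> 1" using S by force
  have uS: "u \<in> (\<lambda>a. - \<nu> / a) ` S" unfolding u_def using S finS by (intro Max_in) auto
  then obtain a0 where a0: "a0 \<in> S" "u = - \<nu> / a0" by auto
  have "\<bar>u\<bar> = \<bar>\<nu>\<bar> / a0" using S(2)[OF a0(1)] by (simp add: a0)
  also have "\<dots> \<le> X / 1" using S(2)[OF a0(1)] X by (intro frac_le) auto
  finally have uX: "\<bar>u\<bar> \<le> X" by simp
  have umax: "- \<nu> / a \<le> u" if "a \<in> S" for a
    unfolding u_def using that finS by (intro Max_ge) auto
  have pos': "0 < a * t + \<nu>" if "a \<in> S" "u < t" for a t
  proof -
    have "- \<nu> / a < t" using umax[OF that(1)] that by simp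
    then show ?thesis using pos[OF that(1)] by (simp add: field_simps)
  qed
  define \<xi> :: complex where "\<xi> = of_real (u + 3 / 2 * r)"
  have Re: "u < Re z" if "z \<in> cball \<xi> r" for z
  proof -
    have "\<bar>Re (\<xi> - z)\<bar> \<le> r" using that abs_Re_le_cmod[of "\<xi> - z"] by (simp add: dist_norm)
    then show ?thesis using r by (simp add: \<xi>_def)
  qed
  \<comment> \<open>From \<open>\<bar>u\<bar> \<le> X\<close> and \<open>r \<le> 2 * X\<close>
    follows \<open>norm z \<le> X + 5 / 2 * r \<le> 6 * X\<close>; the shift adds at most
    \<open>X \<le> X * X\<close>.\<close>
  have nrm: "norm (of_real a * z + of_real \<nu>) \<le> 7 * X\<^sup>2" if a: "a \<in> S" and z: "z \<in> cball \<xi> r" for a z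
  proof -
    have "norm z \<le> norm \<xi> + norm (z - \<xi>)" using norm_triangle_sub by blast
    also have "norm \<xi> \<le> X + 3 / 2 * r"
      unfolding \<xi>_def norm_of_real using uX r by linarith
    also have "norm (z - \<xi>) \<le> r" using z by (simp add: dist_norm norm_minus_commute)
    finally have "norm z \<le> 6 * X" using r by simp
    have "norm (of_real a * z + of_real \<nu>) \<le> norm (of_real a * z) + norm (of_real \<nu> :: complex)"
      by (rule norm_triangle_ineq)
    moreover have "norm (of_real a * z) = a * norm z" using S(2)[OF a] by (simp add: norm_mult)
    moreover have "a * norm z \<le> X * (6 * X)"
      using S(2,3)[OF a] \<open>norm z \<le> 6 * X\<close> X1 by (intro mult_mono) auto
    moreover have "norm (of_real \<nu> :: complex) \<le> X" using X by simp
    moreover have "X \<le> X * X" using X1 by simp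
    moreover have "X * (6 * X) = 6 * (X * X)" by simp
    ultimately show ?thesis unfolding power2_eq_square by linarith
  qed
  have hol: "cradmon e holomorphic_on cball \<xi> r" for e
    by (rule cradmon_holomorphic) (use pos' Re in blast)
  have "\<exists>c::(real \<Rightarrow> nat) \<Rightarrow> int. (\<exists>e\<in>exponents. c e \<noteq> 0) \<and>
    (\<forall>v::real. \<bar>v\<bar> \<le> r / 2 \<longrightarrow> \<bar>\<Sum>e\<in>exponents. of_int (c e) * Re (cradmon e (\<xi> + of_real v))\<bar> < 1)"
  proof (rule small_integer_combination[where B = "(7 * X\<^sup>2) ^ card S" and h = h])
    show "cradmon e holomorphic_on ball \<xi> r" for e
      using hol[of e] by (rule holomorphic_on_subset) auto
    show "continuous_on (cball \<xi> r) (cradmon e)" for e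
      using hol[of e] by (rule holomorphic_on_imp_continuous_on)
    show "norm (cradmon e z) \<le> (7 * X\<^sup>2) ^ card S" if "e \<in> exponents" "z \<in> cball \<xi> r" for e z
    proof (rule norm_cradmon_le[OF that(1)])
      have "1 \<le> X\<^sup>2" using X1 by simp
      then show "1 \<le> 7 * X\<^sup>2" by linarith
    qed (use that pos' Re nrm in auto)
  qed (use h r in \<open>auto simp: card_exponents\<close>)
  then obtain c :: "(real \<Rightarrow> nat) \<Rightarrow> int" where c: "\<exists>e\<in>exponents. c e \<noteq> 0"
    "\<And>v::real. \<bar>v\<bar> \<le> r / 2 \<Longrightarrow> \<bar>\<Sum>e\<in>exponents. of_int (c e) * Re (cradmon e (\<xi> + of_real v))\<bar> < 1"
    by blast
  have sub: "Z \<subseteq> {b \<in> domain. (\<Sum>e\<in>exponents. of_int (c e) * radmon e b) = 0}"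
  proof
    fix b assume b: "b \<in> Z"
    then have dom: "b \<in> domain" using power_point_domain by (auto simp: Z_def)
    define v where "v = b - (u + 3 / 2 * r)"
    have "\<bar>v\<bar> \<le> r / 2" using b unfolding Z_def v_def mem_Collect_eq by linarith
    moreover have "\<xi> + of_real v = of_real b" by (simp add: \<xi>_def v_def)
    ultimately have "\<bar>\<Sum>e\<in>exponents. of_int (c e) * radmon e b\<bar> < 1"
      using c(2)[of v] by (simp add: cradmon_of_real[OF dom])
    moreover have "(\<Sum>e\<in>exponents. of_int (c e) * radmon e b) \<in> \<int>"
      using b by (intro Ints_sum Ints_mult radmon_integer) (auto simp: Z_def)
    ultimately have "(\<Sum>e\<in>exponents. of_int (c e) * radmon e b) = 0"
      using Ints_nonzero_abs_less1 by blast
    with dom show "b \<in> {b \<in> domain. (\<Sum>e\<in>exponents. of_int (c e) * radmon e b) = 0}" by simp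
  qed
  have c': "\<exists>e\<in>exponents. of_int (c e) \<noteq> (0::real)" using c(1) by simp
  note zeros = radmon_combination_zeros[OF c']
  show "finite {b. u + r \<le> b \<and> b \<le> u + 2 * r \<and> power_point b}"
    using finite_subset[OF sub zeros(1)] by (simp add: Z_def)
  show "card {b. u + r \<le> b \<and> b \<le> u + 2 * r \<and> power_point b} \<le> card S * k ^ card S"
    using order_trans[OF card_mono[OF zeros(1) sub] zeros(2)] by (simp add: Z_def)
qed

text \<open>With \<open>u\<close> the rightmost branch point and \<open>X = 2 ^ l\<close>, all
  points lie to the right of \<open>u\<close> at a distance between \<open>1 / X\<close> and
  \<open>2 * X\<close>. Hence \<open>2 * l + 2\<close> dyadic blocks cover them.\<close>

lemma power_points_card:
  fixes l :: nat
  assumes S: "S \<noteq> {}" "\<And>a. a \<in> S \<Longrightarrow> 1 \<le> a" "\<And>a. a \<in> S \<Longrightarrow> a \<le> 2 ^ l"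
    and nuX: "\<bar>\<nu>\<bar> \<le> 2 ^ l" and k2: "2 \<le> k" "k \<le> 2 ^ (l + 1)"
    and l: "1 \<le> l" "46 * l * card S \<le> 2 ^ card S"
    and Z: "\<And>b. b \<in> Z \<Longrightarrow> power_point b" "\<And>b. b \<in> Z \<Longrightarrow> b \<le> 2 ^ l"
  shows "card Z \<le> (2 * l + 2) * (card S * k ^ card S)"
proof -
  define X :: real where "X = 2 ^ l"
  define s where "s = card S"
  define u where "u = Max ((\<lambda>a. - \<nu> / a) ` S)"
  \<comment> \<open>The summands of \<open>h\<close> are exponents of 2 for the factor 16, for
    \<open>k ^ s\<close> and for \<open>(7 * X\<^sup>2) ^ s\<close>, in this order.\<close>
  define h where "h = 4 + (l + 1) * s + (2 * l + 3) * s"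
  have X1: "X \<ge> 1" by (simp add: X_def)
  have s1: "s \<ge> 1" using S finS by (simp add: s_def Suc_le_eq card_gt_0_iff)
  have h1: "16 * real (k ^ s) * (7 * X\<^sup>2) ^ s \<le> 2 ^ h"
  proof -
    have "real (k ^ s) \<le> (2 ^ (l + 1)) ^ s"
      using k2(2) by (metis of_nat_le_iff of_nat_numeral of_nat_power power_mono zero_le)
    moreover have "7 * X\<^sup>2 \<le> 2 ^ (2 * l + 3)"
      by (simp add: X_def power_add power_even_eq)
    then have "(7 * X\<^sup>2) ^ s \<le> (2 ^ (2 * l + 3)) ^ s" by (intro power_mono) auto
    ultimately have "16 * real (k ^ s) * (7 * X\<^sup>2) ^ s \<le> 16 * (2 ^ (l + 1)) ^ s * (2 ^ (2 * l + 3)) ^ s"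
      by (intro mult_mono) auto
    also have "\<dots> = 2 ^ h"
      by (simp only: h_def power_add power_mult) simp
    finally show ?thesis .
  qed
  \<comment> \<open>The constant 46 is \<open>18 + 12 + 16\<close>, after every term is enlarged to
    a multiple of \<open>l * s\<close>.\<close>
  have h2: "4 * h + 2 \<le> k ^ s"
  proof -
    have "4 * h + 2 = 18 + (12 * (l * s) + 16 * s)" by (simp add: h_def algebra_simps)
    also have "\<dots> \<le> 18 * (l * s) + (12 * (l * s) + 16 * (l * s))"
      using l(1) s1 by (intro add_mono) auto
    also have "\<dots> = 46 * l * s" by simp
    also have "\<dots> \<le> 2 ^ s" using l by (simp add: s_def)
    also have "\<dots> \<le> k ^ s" using k2 by (intro power_mono) auto
    finally show ?thesis .
  qed
  define Y where "Y = (\<lambda>j::nat. {b. u + 2 ^ j / X \<le> b \<and> b \<le> u + 2 * (2 ^ j / X) \<and> power_point b})"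
  have Y: "finite (Y j)" "card (Y j) \<le> s * k ^ s" if j: "j < 2 * l + 2" for j
  proof -
    have "(2::real) ^ j \<le> 2 ^ (2 * l + 1)" using j by (intro power_increasing) auto
    also have "\<dots> = 2 * X * X" by (simp add: X_def power_add power_even_eq power2_eq_square)
    finally have "2 ^ j / X \<le> 2 * X" using X1 by (simp add: divide_le_eq)
    moreover have "0 < 2 ^ j / X" using X1 by simp
    ultimately show "finite (Y j)" "card (Y j) \<le> s * k ^ s"
      using power_points_dyadic[of X "2 ^ j / X" h] S nuX h1 h2
      by (simp_all add: Y_def u_def s_def X_def)
  qed
  have "Z \<subseteq> (\<Union>j<2 * l + 2. Y j)"
  proof
    fix b assume b: "b \<in> Z"
    have "u \<in> (\<lambda>a. - \<nu> / a) ` S" unfolding u_def using S finS by (intro Max_in) auto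
    then obtain a0 where a0: "a0 \<in> S" "u = - \<nu> / a0" by auto
    have a1: "1 \<le> a0" "a0 \<le> X" using S a0 by (auto simp: X_def)
    obtain y :: nat where y: "y \<ge> 1" "a0 * b + \<nu> = real y ^ k"
      using Z(1)[OF b] a0 by (auto simp: power_point_def)
    \<comment> \<open>A positive \<open>k\<close>-th power is at least 1, which keeps
      \<open>b\<close> away from the branch point \<open>u\<close>.\<close>
    have "1 \<le> a0 * b + \<nu>" using y by simp
    also have "\<dots> = a0 * (b - u)" using a1 by (simp add: a0(2) field_simps)
    finally have ge: "1 \<le> a0 * (b - u)" .
    then have "b - u > 0" using a1 by (smt (verit) mult_nonneg_nonpos)
    then have q1: "1 \<le> X * (b - u)" using ge a1 mult_right_mono[of a0 X "b - u"] by linarith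
    have "- u = \<nu> / a0" by (simp add: a0)
    also have "\<dots> \<le> \<bar>\<nu>\<bar> / 1" using a1 by (intro frac_le) auto
    finally have "- u \<le> X" using nuX by (simp add: X_def)
    then have "b - u \<le> 2 * X" using Z(2)[OF b] by (simp add: X_def)
    then have "X * (b - u) \<le> X * (2 * X)" using X1 by (intro mult_left_mono) auto
    also have "\<dots> < 2 ^ (2 * l + 2)" by (simp add: X_def power_add power_even_eq power2_eq_square)
    finally have q2: "X * (b - u) < 2 ^ (2 * l + 2)" .
    define n where "n = (LEAST n. X * (b - u) < 2 ^ n)"
    have n: "X * (b - u) < 2 ^ n" unfolding n_def using q2 by (rule LeastI)
    have n2: "n \<le> 2 * l + 2" unfolding n_def using q2 by (rule Least_le)
    obtain j where j: "n = Suc j" using n q1 by (cases n) auto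
    have "\<not> X * (b - u) < 2 ^ j" using not_less_Least[of j "\<lambda>n. X * (b - u) < 2 ^ n"] j n_def by simp
    then have "b \<in> Y j" using n j X1 Z(1)[OF b] by (simp add: Y_def field_simps)
    moreover have "j < 2 * l + 2" using n2 j by simp
    ultimately show "b \<in> (\<Union>j<2 * l + 2. Y j)" by auto
  qed
  then have "card Z \<le> card (\<Union>j<2 * l + 2. Y j)" by (intro card_mono) (auto intro: Y)
  also have "\<dots> \<le> (\<Sum>j<2 * l + 2. card (Y j))" by (rule card_UN_le) simp
  also have "\<dots> \<le> (\<Sum>j<2 * l + 2. s * k ^ s)" by (rule sum_mono) (use Y in auto)
  finally show ?thesis by (simp add: s_def)
qed

end

section \<open>Application to sets with property \<open>D_property\<close>\<close>

lemma common_neighbours_card: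
  fixes S B :: "nat set" and n :: int
  assumes S: "finite S" "S \<noteq> {}" "\<And>a. a \<in> S \<Longrightarrow> 1 \<le> a" "\<And>a. a \<in> S \<Longrightarrow> a \<le> 2 ^ l"
    and B: "\<And>b. b \<in> B \<Longrightarrow> b \<le> 2 ^ l"
    and n: "n \<noteq> 0" "\<bar>n\<bar> \<le> 2 ^ l" and exponent: "2 \<le> k" "k \<le> 2 ^ (l + 1)"
    and l: "1 \<le> l" "46 * l * card S \<le> 2 ^ card S"
    and pow: "\<And>a b. a \<in> S \<Longrightarrow> b \<in> B \<Longrightarrow> \<exists>y::nat. y \<ge> 1 \<and> int a * int b + n = int (y ^ k)"
  shows "card B \<le> (2 * l + 2) * (card S * k ^ card S)"
proof -
  interpret shifted_radicals "real ` S" k "of_int n"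
    using S n exponent by unfold_locales (auto simp: Suc_le_eq)
  have cS: "card (real ` S) = card S" and cB: "card (real ` B) = card B"
    by (auto intro!: card_image inj_onI)
  have "card (real ` B) \<le> (2 * l + 2) * (card (real ` S) * k ^ card (real ` S))"
  proof (rule power_points_card)
    show "power_point b" if b: "b \<in> real ` B" for b
      unfolding power_point_def
    proof
      fix a assume "a \<in> real ` S"
      then obtain a' b' where ab: "a' \<in> S" "b' \<in> B" "a = real a'" "b = real b'" using b by auto
      with pow obtain y :: nat where y: "y \<ge> 1" "int a' * int b' + n = int (y ^ k)" by blast
      then have "of_int (int a' * int b' + n) = (of_int (int (y ^ k)) :: real)" by simp
      then have "a * b + of_int n = real y ^ k" using ab by simp
      with y show "\<exists>y::nat. y \<ge> 1 \<and> a * b + of_int n = real y ^ k" by blast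
    qed
    show "\<bar>real_of_int n\<bar> \<le> 2 ^ l" using n(2) by (metis of_int_abs of_int_le_numeral_power_cancel_iff)
    show "a \<le> 2 ^ l" if "a \<in> real ` S" for a
      using that S(4) by (metis imageE of_nat_le_numeral_power_cancel_iff)
    show "b \<le> 2 ^ l" if "b \<in> real ` B" for b
      using that B by (metis imageE of_nat_le_numeral_power_cancel_iff)
    show "1 \<le> a" if "a \<in> real ` S" for a
      using that S(3) by force
  qed (use S exponent l cS in auto)
  then show ?thesis by (simp only: cS cB)
qed

text \<open>For \<open>y \<ge> 2\<close> the size of \<open>a * b + n\<close>, at most
  \<open>2 ^ (2 * l + 1)\<close>, limits the exponent. The value 1 is a power with any exponent, and
  2 is taken for it.\<close>

lemma perfect_power_exponent_le:
  fixes a b l :: nat and n :: int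
  assumes "int a * int b + n \<in> int ` perfect_powers" "a \<le> 2 ^ l" "b \<le> 2 ^ l" "n \<le> 2 ^ l" and l: "1 \<le> l"
  shows "\<exists>k\<in>{2..2 * l + 1}. \<exists>y::nat. y \<ge> 1 \<and> int a * int b + n = int (y ^ k)"
proof -
  obtain y k :: nat where yk: "y \<ge> 1" "k \<ge> 2" "int a * int b + n = int (y ^ k)"
    using assms(1) by (auto simp: perfect_powers_def)
  show ?thesis
  proof (cases "k \<le> 2 * l + 1")
    case True
    then show ?thesis using yk by auto
  next
    case False
    have "int a * int b \<le> 2 ^ l * 2 ^ l"
      using assms(2,3) by (intro mult_mono) (simp_all add: of_nat_le_numeral_power_cancel_iff)
    moreover have "(2::int) ^ l \<le> 2 ^ l * 2 ^ l" by simp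
    ultimately have "int (y ^ k) \<le> 2 * (2 ^ l * 2 ^ l)" using assms(4) yk(3) by linarith
    also have "\<dots> = int (2 ^ (2 * l + 1))" by (simp add: power_even_eq power2_eq_square)
    finally have le: "y ^ k \<le> 2 ^ (2 * l + 1)" by (simp only: of_nat_le_iff)
    have "y = 1"
    proof (rule ccontr)
      assume "y \<noteq> 1"
      then have "2 ^ k \<le> y ^ k" using yk(1) by (intro power_mono) auto
      then have "(2::nat) ^ k \<le> 2 ^ (2 * l + 1)" using le by linarith
      then have "k \<le> 2 * l + 1" by (rule power_le_imp_le_exp[rotated]) simp
      then show False using False by simp
    qed
    then have y1: "int a * int b + n = int (1 ^ 2)" using yk(3) by simp
    then show ?thesis using l by (intro bexI[of _ 2] exI[of _ 1]) auto
  qed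
qed

text \<open>The biclique and the bound for common neighbours give a power of \<open>8 * l\<close>
  whose exponent is linear in \<open>u\<close>. As \<open>l \<le> 2 ^ u\<close>, this is 2 to a
  quadratic expression in \<open>u\<close>.\<close>

lemma D_property_card_le:
  fixes n :: int and l u :: nat
  assumes A: "\<And>a. a \<in> A \<Longrightarrow> a \<le> 2 ^ l" and n: "n \<noteq> 0" "\<bar>n\<bar> \<le> 2 ^ l"
    and D: "D_property n A" and l: "1 \<le> l" "l \<le> 2 ^ u" and u: "1 \<le> u"
  shows "card A \<le> 2 ^ (176 * u\<^sup>2)"
proof -
  \<comment> \<open>Large enough for \<open>46 * l * s \<le> 2 ^ s\<close> whenever
    \<open>l \<le> 2 ^ u\<close>, yet linear in \<open>u\<close>.\<close>
  define s where "s = 4 * u + 10"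
  define K where "K = 2 * l + 1"
  \<comment> \<open>A common upper bound for \<open>2 * K\<close>, \<open>2 * l + 2\<close> and
    every exponent \<open>k\<close>, so that all factors become powers of \<open>w\<close>.\<close>
  define w where "w = 8 * l"
  define R where "R = (\<lambda>k a b. \<exists>y::nat. y \<ge> 1 \<and> int a * int b + n = int (y ^ k))"
  have finA: "finite A" using A by (intro finite_subset[of A "{..2 ^ l}"]) auto
  have s46: "46 * l * s \<le> 2 ^ s"
  proof -
    have "u \<le> 2 ^ u" by (simp add: less_imp_le)
    then have "14 * u \<le> 14 * 2 ^ u" by (rule mult_le_mono2)
    then have "s \<le> 14 * 2 ^ u" using u unfolding s_def by linarith
    then have "46 * l * s \<le> (46 * 2 ^ u) * (14 * 2 ^ u)" using l by (intro mult_le_mono) auto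
    also have "\<dots> \<le> 1024 * (2 ^ u * 2 ^ u)" by simp
    also have "\<dots> = 2 ^ (2 * u + 10)" by (simp add: power_add power_even_eq power2_eq_square)
    also have "\<dots> \<le> 2 ^ s" by (intro power_increasing) (auto simp: s_def)
    finally show ?thesis .
  qed
  have w1: "w \<ge> 1" using l by (simp add: w_def)
  have sw: "s \<le> w ^ s"
  proof -
    have "s \<le> 2 ^ s" by (simp add: less_imp_le)
    also have "\<dots> \<le> w ^ s" using l by (intro power_mono) (auto simp: w_def)
    finally show ?thesis .
  qed
  have "card A \<le> w ^ (3 * s + 2)"
  proof (cases "2 * (s * K + 1) \<le> card A")
    case True
    have "\<exists>k\<in>{2..2 * l + 1}. \<exists>S B. S \<subseteq> A \<and> B \<subseteq> A \<and> card S = s \<and> (\<forall>a\<in>S. \<forall>b\<in>B. R k a b) \<and>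
           card A \<le> K * (2 * K) ^ s * card B"
    proof (rule monochromatic_biclique[OF finA])
      fix a b assume "a \<in> A" "b \<in> A" "a \<noteq> b"
      then show "\<exists>k\<in>{2..2 * l + 1}. R k a b"
        unfolding R_def using D A n l by (intro perfect_power_exponent_le) (auto simp: D_property_def)
    qed (use True in \<open>auto simp: K_def\<close>)
    then obtain k S B where k: "k \<in> {2..2 * l + 1}" and SB: "S \<subseteq> A" "B \<subseteq> A" "card S = s"
      "\<forall>a\<in>S. \<forall>b\<in>B. R k a b" "card A \<le> K * (2 * K) ^ s * card B" by blast
    have "S \<noteq> {}" using SB(3) by (auto simp: s_def)
    have "l + 1 \<le> 2 ^ l" by (simp add: Suc_le_eq)
    then have kl: "k \<le> 2 ^ (l + 1)" using k by simp
    have "card B \<le> (2 * l + 2) * (card S * k ^ card S)"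
    proof (rule common_neighbours_card[where n = n])
      show "finite S" using SB finA finite_subset by blast
      show "1 \<le> a" if "a \<in> S" for a using D that SB(1) by (auto simp: D_property_def)
      show "46 * l * card S \<le> 2 ^ card S" using s46 SB(3) by simp
    qed (use A SB n k kl l \<open>S \<noteq> {}\<close> in \<open>auto simp: R_def\<close>)
    also have "\<dots> \<le> w * (w ^ s * w ^ s)"
      unfolding SB(3) using sw l k by (intro mult_le_mono power_mono) (auto simp: w_def)
    finally have B: "card B \<le> w * (w ^ s * w ^ s)" .
    have "K * (2 * K) ^ s * card B \<le> w * w ^ s * (w * (w ^ s * w ^ s))"
      using B l by (intro mult_le_mono power_mono) (auto simp: w_def K_def)
    also have "\<dots> = w ^ (3 * s + 2)"
    proof -
      have "3 * s + 2 = (1 + s) + (1 + (s + s))" by simp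
      then show ?thesis by (simp only: power_add power_one_right)
    qed
    finally show ?thesis using SB(5) by linarith
  next
    \<comment> \<open>A set too small for the biclique argument satisfies the same bound
      directly.\<close>
    case False
    then have "card A \<le> 2 * (s * K + 1)" by simp
    also have "\<dots> = s * (2 * K) + 2" by simp
    also have "\<dots> \<le> w ^ s * w + w ^ s * w"
      using sw l w1 by (intro add_le_mono mult_le_mono) (auto simp: w_def K_def intro!: le_trans[OF _ le_trans[of 2 w]])
    also have "\<dots> = 2 * w ^ (s + 1)" by simp
    also have "\<dots> \<le> w * w ^ (s + 1)" using l by (intro mult_le_mono1) (simp add: w_def)
    also have "\<dots> = w ^ (s + 2)" by simp
    also have "\<dots> \<le> w ^ (3 * s + 2)" using w1 by (intro power_increasing) auto
    finally show ?thesis .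
  qed
  also have "\<dots> \<le> (2 ^ (u + 3)) ^ (3 * s + 2)"
    using l by (intro power_mono) (auto simp: w_def power_add)
  also have "\<dots> = 2 ^ ((u + 3) * (3 * s + 2))" by (rule power_mult[symmetric])
  also have "\<dots> \<le> 2 ^ (176 * u\<^sup>2)"
  proof (rule power_increasing)
    have "(u + 3) * (3 * s + 2) \<le> (4 * u) * (44 * u)" using u by (intro mult_le_mono) (auto simp: s_def)
    then show "(u + 3) * (3 * s + 2) \<le> 176 * u\<^sup>2" by (simp add: power2_eq_square)
  qed simp
  finally show ?thesis .
qed

section \<open>Choice of the scale and of the final constants\<close>

theorem corollary2p3:
  "\<exists>L C :: real. L > 0 \<and> C > 0 \<and>
     (\<forall>x::real. x > 1 \<longrightarrow>
        f x \<le> f_tilde x \<and> real (f_tilde x) \<le> C * exp (L * (ln (ln x))\<^sup>2))"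
proof (rule exI[of _ 4400], rule exI[of _ "exp (exp 1)"], intro conjI allI impI)
  \<comment> \<open>The constant 4400 is \<open>176 * 5\<^sup>2\<close>, from the exponent
    \<open>176 * u\<^sup>2\<close> with \<open>u \<le> 5 * ln (ln x)\<close>. The factor
    \<open>exp (exp 1)\<close> absorbs the range \<open>x \<le> exp (exp 1)\<close>, where the
    trivial bound by \<open>x\<close> is used.\<close>
  fix x :: real assume x: "x > 1"
  show "f x \<le> f_tilde x"
    unfolding f_def f_tilde_def
  proof (rule Max_mono)
    show "{card A |A. (\<forall>a\<in>A. 1 \<le> a \<and> real a \<le> x) \<and> (\<exists>n::int. 1 \<le> n \<and> of_int n \<le> x \<and> D_property n A)}
      \<subseteq> {card A |A. (\<forall>a\<in>A. 1 \<le> a \<and> real a \<le> x) \<and> (\<exists>n::int. 1 \<le> \<bar>n\<bar> \<and> of_int \<bar>n\<bar> \<le> x \<and> D_property n A)}"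
      by force
    show "{card A |A. (\<forall>a\<in>A. 1 \<le> a \<and> real a \<le> x) \<and> (\<exists>n::int. 1 \<le> n \<and> of_int n \<le> x \<and> D_property n A)} \<noteq> {}"
      using zero_in_cards(1)[of x] x by (metis (lifting) empty_iff less_imp_le)
  qed (rule finite_cards)
  have "f_tilde x \<in> {card A |A. (\<forall>a\<in>A. 1 \<le> a \<and> real a \<le> x) \<and> (\<exists>n::int. 1 \<le> \<bar>n\<bar> \<and> of_int \<bar>n\<bar> \<le> x \<and> D_property n A)}"
    unfolding f_tilde_def
  proof (rule Max_in[OF finite_cards])
    show "{card A |A. (\<forall>a\<in>A. 1 \<le> a \<and> real a \<le> x) \<and> (\<exists>n::int. 1 \<le> \<bar>n\<bar> \<and> of_int \<bar>n\<bar> \<le> x \<and> D_property n A)} \<noteq> {}"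
      using zero_in_cards(2)[of x] x by (metis (lifting) empty_iff less_imp_le)
  qed
  then obtain A and n :: int where A: "f_tilde x = card A" "\<And>a. a \<in> A \<Longrightarrow> 1 \<le> a"
      "\<And>a. a \<in> A \<Longrightarrow> real a \<le> x" and n: "1 \<le> \<bar>n\<bar>" "of_int \<bar>n\<bar> \<le> x" "D_property n A"
    by auto
  define t where "t = ln (ln x)"
  show "real (f_tilde x) \<le> exp (exp 1) * exp (4400 * (ln (ln x))\<^sup>2)"
  proof (cases "x \<le> exp (exp 1)")
    case True
    have "A \<subseteq> {1..nat \<lfloor>x\<rfloor>}" using A by (auto simp: le_nat_floor)
    then have "card A \<le> nat \<lfloor>x\<rfloor>" using card_mono[of "{1..nat \<lfloor>x\<rfloor>}" A] by simp
    then have "real (card A) \<le> x" using x by linarith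
    also have "\<dots> \<le> exp (exp 1) * 1" using True by simp
    also have "\<dots> \<le> exp (exp 1) * exp (4400 * (ln (ln x))\<^sup>2)" by (intro mult_left_mono) auto
    finally show ?thesis using A(1) by simp
  next
    case False
    then have "exp 1 < ln x" using x by (metis exp_less_cancel_iff exp_ln less_trans not_le zero_less_one)
    moreover have "0 < ln x" using x by simp
    ultimately have t1: "1 \<le> t" unfolding t_def
      by (metis exp_less_cancel_iff exp_ln less_imp_le)
    have et: "exp t = ln x" using \<open>0 < ln x\<close> by (simp add: t_def)
    \<comment> \<open>\<open>2 ^ u\<close> has to reach \<open>ln x / ln 2\<close>. Since
      \<open>ln 2 \<ge> 1 / 2\<close>, it is at least \<open>exp (2 * t) \<ge> 2 * exp t\<close>,
      which suffices. Rounding up costs at most \<open>t\<close>, because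
      \<open>t \<ge> 1\<close>.\<close>
    define u where "u = nat \<lceil>4 * t\<rceil>"
    have u: "4 * t \<le> real u" "real u \<le> 5 * t" "1 \<le> u" using t1 unfolding u_def by linarith+
    have ln2: "1 / 2 \<le> ln (2::real)" using ln2_ge_two_thirds by simp
    have "2 * exp t \<le> exp t * exp t"
    proof (rule mult_right_mono)
      show "2 \<le> exp t" using exp_ge_add_one_self[of t] t1 by linarith
    qed simp
    also have "\<dots> = exp (4 * t * (1 / 2))" by (simp flip: exp_add)
    also have "\<dots> \<le> exp (real u * ln 2)" using u t1 ln2 by (subst exp_le_cancel_iff, intro mult_mono) auto
    also have "\<dots> = 2 ^ u" by (simp add: exp_of_nat_mult)
    finally have "2 * exp t * (1 / 2) \<le> 2 ^ u * ln 2" using ln2 by (intro mult_mono) auto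
    then have "ln x \<le> real (2 ^ u) * ln 2" by (simp add: et)
    then have "exp (ln x) \<le> exp (real (2 ^ u) * ln 2)" by (simp only: exp_le_cancel_iff)
    then have x2: "x \<le> 2 ^ (2 ^ u)" using x by (simp add: exp_of_nat_mult del: of_nat_power)
    have "card A \<le> 2 ^ (176 * u\<^sup>2)"
    proof (rule D_property_card_le[where l = "2 ^ u"])
      show "a \<le> 2 ^ 2 ^ u" if "a \<in> A" for a
        using A(3)[OF that] x2 by (metis of_nat_le_numeral_power_cancel_iff order_trans)
      show "\<bar>n\<bar> \<le> 2 ^ 2 ^ u"
        using n(2) x2 by (metis of_int_le_numeral_power_cancel_iff order_trans)
    qed (use n u in auto)
    then have "real (card A) \<le> 2 ^ (176 * u\<^sup>2)" by (metis of_nat_le_numeral_power_cancel_iff)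
    also have "\<dots> \<le> exp 1 ^ (176 * u\<^sup>2)"
      using exp_ge_add_one_self[of 1] by (intro power_mono) auto
    also have "\<dots> = exp (176 * (real u)\<^sup>2)" by (simp flip: exp_of_nat_mult)
    also have "\<dots> \<le> exp (4400 * t\<^sup>2)"
    proof -
      have "(real u)\<^sup>2 \<le> (5 * t)\<^sup>2" using u by (intro power_mono) auto
      then show ?thesis by (simp add: power_mult_distrib)
    qed
    also have "\<dots> = 1 * exp (4400 * t\<^sup>2)" by simp
    also have "\<dots> \<le> exp (exp 1) * exp (4400 * t\<^sup>2)" by (intro mult_right_mono) auto
    finally show ?thesis using A(1) by (simp add: t_def)
  qed
qed simp_all

end
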